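(* Let $\mathcal{C}=\{(\mathbf{p}_i,\mathbf{q}_i)\}_{i=1}^M$ with $\mathbf{p}_i,\mathbf{q}_i\in\mathbb{R}^3$ and let $\epsilon>0$. Let $\mathcal{C}'$ be the output of the fast match pruning (FMP) algorithm on input $(\mathcal{C},\epsilon)$. Then $\mathcal{I}^*\subseteq\mathcal{C}'\subseteq\mathcal{C}$, and the optimal solution is preserved: $$\operatorname*{arg\,max}_{\theta,\mathbf{t}}E(\theta,\mathbf{t}\mid\mathcal{C},\epsilon)=\operatorname*{arg\,max}_{\theta,\mathbf{t}}E(\theta,\mathbf{t}\mid\mathcal{C}',\epsilon).$$ Moreover, FMP is deterministic and runs in $\mathcal{O}(M^2\log M)$ time.
   Context: For $\theta\in[0,2\pi]$, $\mathbf{R}(\theta)=\begin{pmatrix}\cos\theta&\sin\theta&0\\-\sin\theta&\cos\theta&0\\0&0&1\end{pmatrix}$; $\mathbb{I}$ is 1 if its argument is true and 0 otherwise; $\|\cdot\|$ is the Euclidean norm. For a set $\mathcal{D}$ of pairs of points, $\theta\in[0,2\pi]$ and $\mathbf{t}\in\mathbb{R}^3$, $E(\theta,\mathbf{t}\mid\mathcal{D},\epsilon)=\sum_{(\mathbf{p},\mathbf{q})\in\mathcal{D}}\mathbb{I}\left(\|\mathbf{R}(\theta)\mathbf{p}+\mathbf{t}-\mathbf{q}\|\le\epsilon\right)$. Let $(\theta^*,\mathbf{t}^* )$ be a maximizer of $E(\cdot,\cdot\mid\mathcal{C},\epsilon)$ over $[0,2\pi]\times\mathbb{R}^3$, and let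 $\mathcal{I}^*$ be the set of pairs $(\mathbf{p}_i,\mathbf{q}_i)\in\mathcal{C}$ with $\|\mathbf{R}(\theta^* )\mathbf{p}_i+\mathbf{t}^*-\mathbf{q}_i\|\le\epsilon$. FMP algorithm. Initialize $\underline{E}:=0$, $\mathcal{C}':=\mathcal{C}$. For $k=1,\dots,M$: (i) solve the problem $\mathcal{Q}[k]$: maximize $1+\sum_{i\in\{1,\dots,M\}\setminus\{k\}}\mathbb{I}\left(\|\mathbf{R}(\theta)(\mathbf{p}_i-\mathbf{p}_k)-(\mathbf{q}_i-\mathbf{q}_k)\|\le2\epsilon\right)$ over $\theta\in[0,2\pi]$; let $\bar{E}_k$ be its optimal value and $\tilde{\theta}_k$ a maximizer (computed by a deterministic $\mathcal{O}(M\log M)$-time interval max-stabbing procedure); (ii) if $\bar{E}_k<\underline{E}$, set $\mathcal{C}':=\mathcal{C}'\setminus\{(\mathbf{p}_k,\mathbf{q}_k)\}$; otherwise put $\tilde{\mathbf{t}}_k=\mathbf{q}_k-\mathbf{R}(\tilde{\theta}_k)\mathbf{p}_k$ and set $\underline{E}:=E(\tilde{\theta}_k,\tilde{\mathbf{t}}_k\mid\mathcal{C}',\epsilon)$. After the loop, remove from $\mathcal{C}'$ every remaining $(\mathbf{p}_k,\mathbf{q}_k)$ with $\bar{E}_k<\underline{E}$, and return $\mathcal{C}'$. Running time counts arithmetic operations, comparisons, square roots and (inverse) trigonometric evaluations on real numbers as unit cost. *)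

theory Defs
  imports "HOL-Analysis.Analysis" "HOL-Library.Landau_Symbols" "HOL-Library.Monad_Syntax"
begin

section \<open>The registration problem\<close>

type_synonym point = "real^3"
type_synonym match = "point \<times> point"

definition Rot :: "real \<Rightarrow> real^3^3" where
  "Rot \<theta> = vector [vector [cos \<theta>, sin \<theta>, 0],
                   vector [- sin \<theta>, cos \<theta>, 0],
                   vector [0, 0, 1]]"

definition consensus :: "real \<Rightarrow> match set \<Rightarrow> real \<Rightarrow> point \<Rightarrow> real" where
  "consensus \<epsilon> D \<theta> t = (\<Sum>(p, q)\<in>D. of_bool (norm (Rot \<theta> *v p + t - q) \<le> \<epsilon>))"

definition inliers :: "real \<Rightarrow> match set \<Rightarrow> real \<Rightarrow> point \<Rightarrow> match set" where
  "inliers \<epsilon> D \<theta> t = {(p, q) \<in> D. norm (Rot \<theta> *v p + t - q) \<le> \<epsilon>}"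

definition argmax_consensus :: "real \<Rightarrow> match set \<Rightarrow> (real \<times> point) set" where
  "argmax_consensus \<epsilon> D =
     {x. is_arg_max (\<lambda>(\<theta>, t). consensus \<epsilon> D \<theta> t) (\<lambda>(\<theta>, t). \<theta> \<in> {0..2 * pi}) x}"


section \<open>The FMP algorithm\<close>

text \<open>The input is a list \<open>C\<close> enumerating the correspondences, with indices \<open>0, \<dots>, M - 1\<close> where
  \<open>M = length C\<close>; repetitions are permitted. The set of correspondences is \<open>set C\<close>.\<close>

definition Q_obj :: "real \<Rightarrow> match list \<Rightarrow> nat \<Rightarrow> real \<Rightarrow> real" where
  "Q_obj \<epsilon> C k \<theta> = 1 + (\<Sum>i\<in>{..<length C} - {k}.
     of_bool (norm (Rot \<theta> *v (fst (C ! i) - fst (C ! k)) - (snd (C ! i) - snd (C ! k))) \<le> 2 * \<epsilon>))"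

definition solves_Q :: "real \<Rightarrow> match list \<Rightarrow> nat \<Rightarrow> real \<Rightarrow> real \<Rightarrow> bool" where
  "solves_Q \<epsilon> C k v \<theta> \<longleftrightarrow>
     is_arg_max (Q_obj \<epsilon> C k) (\<lambda>\<theta>. \<theta> \<in> {0..2 * pi}) \<theta> \<and> v = Q_obj \<epsilon> C k \<theta>"

text \<open>The algorithm on sets, given optimal values \<open>Eb k\<close> and maximizers \<open>\<theta> k\<close> of the problems
  \<open>Q[k]\<close>. The state consists of the current lower bound and the current set of matches.\<close>

definition fmp_step :: "real \<Rightarrow> match list \<Rightarrow> (nat \<Rightarrow> real) \<Rightarrow> (nat \<Rightarrow> real) \<Rightarrow>
    nat \<Rightarrow> real \<times> match set \<Rightarrow> real \<times> match set" where
  "fmp_step \<epsilon> C Eb \<theta> k = (\<lambda>(E, D).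
     if Eb k < E then (E, D - {C ! k})
     else (consensus \<epsilon> D (\<theta> k) (snd (C ! k) - Rot (\<theta> k) *v fst (C ! k)), D))"

definition fmp :: "real \<Rightarrow> match list \<Rightarrow> (nat \<Rightarrow> real) \<Rightarrow> (nat \<Rightarrow> real) \<Rightarrow> match set" where
  "fmp \<epsilon> C Eb \<theta> =
     (let (E, D) = fold (fmp_step \<epsilon> C Eb \<theta>) [0..<length C] (0, set C)
      in D - {C ! k | k. k < length C \<and> Eb k < E})"


section \<open>Unit-cost computations\<close>

text \<open>A computation is the set of its possible outcomes, each with the number of unit-cost operations
  spent. A computation may thus be nondeterministic a priori; it is deterministic and terminating
  precisely if it has exactly one outcome.\<close>

datatype 'a comp = Comp (outcomes: "('a \<times> nat) set")

definition ret :: "'a \<Rightarrow> 'a comp" where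
  "ret x = Comp {(x, 0)}"

definition bind_comp :: "'a comp \<Rightarrow> ('a \<Rightarrow> 'b comp) \<Rightarrow> 'b comp" where
  "bind_comp m f = Comp {(y, a + b) | x a y b. (x, a) \<in> outcomes m \<and> (y, b) \<in> outcomes (f x)}"

adhoc_overloading Monad_Syntax.bind \<rightleftharpoons> bind_comp

text \<open>\<open>op e\<close> charges one unit for the value \<open>e\<close>. In all programs below \<open>e\<close> is one single arithmetic
  operation, comparison, square root or (inverse) trigonometric function, applied to constants and
  to values that are already available. In addition \<open>tick\<close> charges one unit for every recursive
  call, so that traversing or building lists is not free.\<close>

definition op :: "'a \<Rightarrow> 'a comp" where
  "op x = Comp {(x, 1)}"

abbreviation tick :: "unit comp" where
  "tick \<equiv> op ()"

lemma bind_comp_cong [fundef_cong]: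
  assumes "m = m'" and "\<And>x a. (x, a) \<in> outcomes m' \<Longrightarrow> f x = g x"
  shows "bind_comp m f = bind_comp m' g"
  using assms unfolding bind_comp_def by (auto; metis)

lemma outcomes_op [simp]: "outcomes (op x) = {(x, 1)}"
  by (simp add: op_def)


section \<open>FMP as a unit-cost program\<close>

subsection \<open>Geometry\<close>

definition add_prog :: "point \<Rightarrow> point \<Rightarrow> point comp" where
  "add_prog a b = do {
     x \<leftarrow> op (a $ 1 + b $ 1);
     y \<leftarrow> op (a $ 2 + b $ 2);
     z \<leftarrow> op (a $ 3 + b $ 3);
     ret (vector [x, y, z])
   }"

definition sub_prog :: "point \<Rightarrow> point \<Rightarrow> point comp" where
  "sub_prog a b = do {
     x \<leftarrow> op (a $ 1 - b $ 1);
     y \<leftarrow> op (a $ 2 - b $ 2);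
     z \<leftarrow> op (a $ 3 - b $ 3);
     ret (vector [x, y, z])
   }"

definition sqnorm_prog :: "point \<Rightarrow> real comp" where
  "sqnorm_prog a = do {
     xx \<leftarrow> op (a $ 1 * a $ 1);
     yy \<leftarrow> op (a $ 2 * a $ 2);
     zz \<leftarrow> op (a $ 3 * a $ 3);
     s \<leftarrow> op (xx + yy);
     op (s + zz)
   }"

definition rot_prog :: "real \<Rightarrow> point \<Rightarrow> point comp" where
  "rot_prog \<theta> a = do {
     c \<leftarrow> op (cos \<theta>);
     s \<leftarrow> op (sin \<theta>);
     cx \<leftarrow> op (c * a $ 1);
     sy \<leftarrow> op (s * a $ 2);
     sx \<leftarrow> op (s * a $ 1);
     cy \<leftarrow> op (c * a $ 2);
     x \<leftarrow> op (cx + sy);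
     y \<leftarrow> op (cy - sx);
     ret (vector [x, y, a $ 3])
   }"

fun consensus_prog :: "real \<Rightarrow> match list \<Rightarrow> real \<Rightarrow> point \<Rightarrow> real comp" where
  "consensus_prog \<epsilon> [] \<theta> t = do { tick; ret 0 }"
| "consensus_prog \<epsilon> ((p, q) # D) \<theta> t = do {
     tick;
     n \<leftarrow> consensus_prog \<epsilon> D \<theta> t;
     a \<leftarrow> rot_prog \<theta> p;
     b \<leftarrow> add_prog a t;
     d \<leftarrow> sub_prog b q;
     s \<leftarrow> sqnorm_prog d;
     r \<leftarrow> op (sqrt s);
     inlier \<leftarrow> op (r \<le> \<epsilon>);
     if inlier then op (n + 1) else ret n
   }"


subsection \<open>Sets of matches, as lists without repetition\<close>

definition eq_point_prog :: "point \<Rightarrow> point \<Rightarrow> bool comp" where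
  "eq_point_prog a b = do {
     x \<leftarrow> op (a $ 1 = b $ 1);
     y \<leftarrow> op (a $ 2 = b $ 2);
     z \<leftarrow> op (a $ 3 = b $ 3);
     ret (x \<and> y \<and> z)
   }"

fun remove_prog :: "match \<Rightarrow> match list \<Rightarrow> match list comp" where
  "remove_prog m [] = do { tick; ret [] }"
| "remove_prog m (m' # D) = do {
     tick;
     D' \<leftarrow> remove_prog m D;
     e1 \<leftarrow> eq_point_prog (fst m) (fst m');
     e2 \<leftarrow> eq_point_prog (snd m) (snd m');
     if e1 \<and> e2 then ret D' else ret (m' # D')
   }"

fun to_set_prog :: "match list \<Rightarrow> match list comp" where
  "to_set_prog [] = do { tick; ret [] }"
| "to_set_prog (m # C) = do {
     tick;
     D \<leftarrow> to_set_prog C;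
     D' \<leftarrow> remove_prog m D;
     ret (m # D')
   }"


subsection \<open>Solving \<open>Q[k]\<close> by interval max-stabbing\<close>

text \<open>The angles \<open>\<theta> \<in> [0, 2\<pi>]\<close> with \<open>norm (Rot \<theta> *v a - b) \<le> 2 * \<epsilon>\<close>, as at most two disjoint closed
  intervals (left endpoint, right endpoint). Squaring turns the condition into
  \<open>u * cos \<theta> + v * sin \<theta> \<ge> w\<close>, that is \<open>\<rho> * cos (\<theta> - \<phi>) \<ge> w\<close> with \<open>(u, v) = \<rho> * (cos \<phi>, sin \<phi>)\<close>.\<close>

definition arcs_prog :: "real \<Rightarrow> point \<Rightarrow> point \<Rightarrow> (real \<times> real) list comp" where
  "arcs_prog \<epsilon> a b = do {
     na \<leftarrow> sqnorm_prog a;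
     nb \<leftarrow> sqnorm_prog b;
     n \<leftarrow> op (na + nb);
     d \<leftarrow> op (2 * \<epsilon>);
     dd \<leftarrow> op (d * d);
     h2 \<leftarrow> op (n - dd);
     h \<leftarrow> op (h2 / 2);
     z \<leftarrow> op (a $ 3 * b $ 3);
     w \<leftarrow> op (h - z);
     u1 \<leftarrow> op (a $ 1 * b $ 1);
     u2 \<leftarrow> op (a $ 2 * b $ 2);
     u \<leftarrow> op (u1 + u2);
     v1 \<leftarrow> op (a $ 2 * b $ 1);
     v2 \<leftarrow> op (a $ 1 * b $ 2);
     v \<leftarrow> op (v1 - v2);
     uu \<leftarrow> op (u * u);
     vv \<leftarrow> op (v * v);
     rr \<leftarrow> op (uu + vv);
     \<rho> \<leftarrow> op (sqrt rr);
     \<rho>' \<leftarrow> op (- \<rho>);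
     twopi \<leftarrow> op (2 * pi);
     everything \<leftarrow> op (w \<le> \<rho>');
     if everything then ret [(0, twopi)] else do {
       nothing \<leftarrow> op (\<rho> < w);
       if nothing then ret [] else do {
         cphi \<leftarrow> op (u / \<rho>);
         \<phi>0 \<leftarrow> op (arccos cphi);
         lower_half \<leftarrow> op (v < 0);
         \<phi> \<leftarrow> (if lower_half then op (twopi - \<phi>0) else ret \<phi>0);
         calpha \<leftarrow> op (w / \<rho>);
         \<alpha> \<leftarrow> op (arccos calpha);
         l \<leftarrow> op (\<phi> - \<alpha>);
         r \<leftarrow> op (\<phi> + \<alpha>);
         wraps_left \<leftarrow> op (l \<le> 0);
         if wraps_left then do {
           l' \<leftarrow> op (l + twopi);
           ret [(0, r), (l', twopi)]
         } else do {
           wraps_right \<leftarrow> op (twopi \<le> r);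
           if wraps_right then do {
             r' \<leftarrow> op (r - twopi);
             ret [(l, twopi), (0, r')]
           } else ret [(l, r)]
         }
       }
     }
   }"

text \<open>The left and the right endpoints of the intervals of all matches \<open>i \<noteq> k\<close>; the argument \<open>i\<close> is
  the index of the head of the list.\<close>

fun endpoints_prog :: "real \<Rightarrow> match \<Rightarrow> nat \<Rightarrow> nat \<Rightarrow> match list \<Rightarrow> (real list \<times> real list) comp" where
  "endpoints_prog \<epsilon> m k i [] = do { tick; ret ([], []) }"
| "endpoints_prog \<epsilon> m k i (m' # C) = do {
     tick;
     i' \<leftarrow> op (i + 1);
     (ls, rs) \<leftarrow> endpoints_prog \<epsilon> m k i' C;
     self \<leftarrow> op (i = k);
     if self then ret (ls, rs) else do {
       a \<leftarrow> sub_prog (fst m') (fst m);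
       b \<leftarrow> sub_prog (snd m') (snd m);
       arcs \<leftarrow> arcs_prog \<epsilon> a b;
       ret (map fst arcs @ ls, map snd arcs @ rs)
     }
   }"

fun length_prog :: "real list \<Rightarrow> nat comp" where
  "length_prog [] = do { tick; ret 0 }"
| "length_prog (x # xs) = do { tick; n \<leftarrow> length_prog xs; op (n + 1) }"

fun merge_prog :: "real list \<Rightarrow> real list \<Rightarrow> real list comp" where
  "merge_prog [] ys = do { tick; ret ys }"
| "merge_prog (x # xs) [] = do { tick; ret (x # xs) }"
| "merge_prog (x # xs) (y # ys) = do {
     tick;
     le \<leftarrow> op (x \<le> y);
     if le then do { zs \<leftarrow> merge_prog xs (y # ys); ret (x # zs) }
     else do { zs \<leftarrow> merge_prog (x # xs) ys; ret (y # zs) }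
   }"

text \<open>Sorts the first \<open>n\<close> elements of a list and also returns the remaining elements.\<close>

function msort_prog :: "nat \<Rightarrow> real list \<Rightarrow> (real list \<times> real list) comp" where
  "msort_prog n xs = do {
     tick;
     small \<leftarrow> op (n \<le> 1);
     if small then do {
       empty \<leftarrow> op (n = 0);
       if empty then ret ([], xs) else ret (take 1 xs, drop 1 xs)
     } else do {
       n1 \<leftarrow> op (n div 2);
       n2 \<leftarrow> op (n - n1);
       (as, ys) \<leftarrow> msort_prog n1 xs;
       (bs, zs) \<leftarrow> msort_prog n2 ys;
       cs \<leftarrow> merge_prog as bs;
       ret (cs, zs)
     }
   }"
  by pat_completeness auto
termination
  by (relation "Wellfounded.measure fst") auto

definition sort_prog :: "real list \<Rightarrow> real list comp" where
  "sort_prog xs = do {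
     n \<leftarrow> length_prog xs;
     (ys, _) \<leftarrow> msort_prog n xs;
     ret ys
   }"

text \<open>Sweeps the sorted left and right endpoints; \<open>n\<close> is the number of intervals currently open,
  \<open>best\<close> the largest such number so far, and \<open>\<theta>\<close> a point where it is attained. At equal
  coordinates left endpoints come first, as the intervals are closed.\<close>

fun sweep_prog :: "real list \<Rightarrow> real list \<Rightarrow> real \<Rightarrow> real \<Rightarrow> real \<Rightarrow> (real \<times> real) comp" where
  "sweep_prog [] rs n best \<theta> = do { tick; ret (best, \<theta>) }"
| "sweep_prog (l # ls) [] n best \<theta> = do { tick; ret (best, \<theta>) }"
| "sweep_prog (l # ls) (r # rs) n best \<theta> = do {
     tick;
     opens \<leftarrow> op (l \<le> r);
     if opens then do {
       n' \<leftarrow> op (n + 1);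
       better \<leftarrow> op (best < n');
       if better then sweep_prog ls (r # rs) n' n' l
       else sweep_prog ls (r # rs) n' best \<theta>
     } else do {
       n' \<leftarrow> op (n - 1);
       sweep_prog (l # ls) rs n' best \<theta>
     }
   }"

definition solve_Q_prog :: "real \<Rightarrow> match list \<Rightarrow> nat \<Rightarrow> match \<Rightarrow> (real \<times> real) comp" where
  "solve_Q_prog \<epsilon> C k m = do {
     (ls, rs) \<leftarrow> endpoints_prog \<epsilon> m k 0 C;
     ls' \<leftarrow> sort_prog ls;
     rs' \<leftarrow> sort_prog rs;
     (best, \<theta>) \<leftarrow> sweep_prog ls' rs' 0 0 0;
     v \<leftarrow> op (1 + best);
     ret (v, \<theta>)
   }"


subsection \<open>Main loop\<close>

text \<open>\<open>ms\<close> are the matches still to be visited, \<open>k\<close> is the index of the first one, and \<open>vs\<close> records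
  the visited matches together with the optimal values of their problems \<open>Q[k]\<close>.\<close>

fun loop_prog :: "real \<Rightarrow> match list \<Rightarrow> nat \<Rightarrow> match list \<Rightarrow> real \<Rightarrow> match list \<Rightarrow> (match \<times> real) list \<Rightarrow>
    (real \<times> match list \<times> (match \<times> real) list) comp" where
  "loop_prog \<epsilon> C k [] E D vs = do { tick; ret (E, D, vs) }"
| "loop_prog \<epsilon> C k (m # ms) E D vs = do {
     tick;
     (v, \<theta>) \<leftarrow> solve_Q_prog \<epsilon> C k m;
     k' \<leftarrow> op (k + 1);
     prune \<leftarrow> op (v < E);
     if prune then do {
       D' \<leftarrow> remove_prog m D;
       loop_prog \<epsilon> C k' ms E D' ((m, v) # vs)
     } else do {
       a \<leftarrow> rot_prog \<theta> (fst m);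
       t \<leftarrow> sub_prog (snd m) a;
       E' \<leftarrow> consensus_prog \<epsilon> D \<theta> t;
       loop_prog \<epsilon> C k' ms E' D ((m, v) # vs)
     }
   }"

fun final_prog :: "real \<Rightarrow> match list \<Rightarrow> (match \<times> real) list \<Rightarrow> match list comp" where
  "final_prog E D [] = do { tick; ret D }"
| "final_prog E D ((m, v) # vs) = do {
     tick;
     prune \<leftarrow> op (v < E);
     if prune then do { D' \<leftarrow> remove_prog m D; final_prog E D' vs }
     else final_prog E D vs
   }"

definition fmp_prog :: "real \<Rightarrow> match list \<Rightarrow> match list comp" where
  "fmp_prog \<epsilon> C = do {
     D \<leftarrow> to_set_prog C;
     (E, D', vs) \<leftarrow> loop_prog \<epsilon> C 0 C 0 D [];
     final_prog E D' vs
   }"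

end

theory Submission
  imports Defs "HOL-Library.Multiset" "HOL-Real_Asymp.Real_Asymp"
begin

text \<open>If a match \<open>C ! k\<close> is an inlier at \<open>(\<theta>, t)\<close>, then subtracting its residual from that of any other
  inlier eliminates \<open>t\<close> and gives a vector of norm at most \<open>2 * \<epsilon>\<close>; hence the number of inliers at
  \<open>(\<theta>, t)\<close> is bounded by the optimal value of \<open>Q[k]\<close>. The lower bound maintained by FMP is the consensus
  of a subset of the matches at an actual angle and translation, so it never exceeds the global optimum,
  and an inlier of an optimal solution is never pruned. A subset that contains the inliers of every
  maximizer has the same maximizers.

  For the program, the angles compatible with a pair of matches form at most two disjoint arcs, so \<open>Q[k]\<close>
  asks for a point covered by a maximal number of intervals. This maximum is attained at a left endpoint,
  which a sweep over the sorted endpoints finds in time \<open>O(M log M)\<close>.\<close>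

section \<open>Pruning preserves the optimal solutions\<close>

lemma consensus_eq_card:
  assumes "finite D"
  shows "consensus \<epsilon> D \<theta> t = real (card (inliers \<epsilon> D \<theta> t))"
proof -
  have "inliers \<epsilon> D \<theta> t = {x \<in> D. norm (Rot \<theta> *v fst x + t - snd x) \<le> \<epsilon>}"
    by (auto simp: inliers_def)
  then show ?thesis
    using assms by (simp add: consensus_def case_prod_unfold of_bool_def sum.If_cases Int_def)
qed

lemma consensus_le_Q_obj:
  assumes "k < length C" "C ! k \<in> inliers \<epsilon> (set C) \<theta> t"
  shows "consensus \<epsilon> (set C) \<theta> t \<le> Q_obj \<epsilon> C k \<theta>"
proof -
  define I where "I = inliers \<epsilon> (set C) \<theta> t"
  define J where "J = {i \<in> {..<length C} - {k}.
     norm (Rot \<theta> *v (fst (C ! i) - fst (C ! k)) - (snd (C ! i) - snd (C ! k))) \<le> 2 * \<epsilon>}"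
  have fin: "finite I" "finite J"
    by (auto simp: I_def J_def inliers_def intro: rev_finite_subset[of "set C"])
  \<comment> \<open>\<open>Q_obj\<close> counts indices, the consensus counts distinct matches.
    Covering by an image of \<open>J\<close> suffices, as a repeated match only enlarges
    \<open>J\<close>; the removed \<open>C ! k\<close> accounts for the leading 1 of
    \<open>Q_obj\<close>.\<close>
  have "I - {C ! k} \<subseteq> (!) C ` J"
  proof
    fix m assume m: "m \<in> I - {C ! k}"
    then obtain i where i: "i < length C" "m = C ! i"
      by (auto simp: I_def inliers_def in_set_conv_nth)
    have "norm (Rot \<theta> *v fst m + t - snd m) \<le> \<epsilon>" "norm (Rot \<theta> *v fst (C ! k) + t - snd (C ! k)) \<le> \<epsilon>"
      using m assms(2) by (auto simp: I_def inliers_def)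
    then have "norm ((Rot \<theta> *v fst m + t - snd m) - (Rot \<theta> *v fst (C ! k) + t - snd (C ! k))) \<le> \<epsilon> + \<epsilon>"
      by (rule order.trans[OF norm_triangle_ineq4 add_mono])
    moreover have "(Rot \<theta> *v fst m + t - snd m) - (Rot \<theta> *v fst (C ! k) + t - snd (C ! k)) =
      Rot \<theta> *v (fst m - fst (C ! k)) - (snd m - snd (C ! k))"
      by (simp add: matrix_vector_mult_diff_distrib algebra_simps)
    ultimately have "norm (Rot \<theta> *v (fst m - fst (C ! k)) - (snd m - snd (C ! k))) \<le> 2 * \<epsilon>"
      by (simp only: mult_2)
    then show "m \<in> (!) C ` J"
      using i m by (auto simp: J_def)
  qed
  then have "card (I - {C ! k}) \<le> card J"
    using fin(2) by (meson card_image_le card_mono finite_imageI order.trans)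
  moreover have "card I = Suc (card (I - {C ! k}))"
    using card_Suc_Diff1[OF fin(1)] assms(2) by (simp add: I_def)
  moreover have "Q_obj \<epsilon> C k \<theta> = 1 + real (card J)"
    by (simp add: Q_obj_def J_def of_bool_def sum.If_cases Int_def)
  ultimately show ?thesis
    by (simp add: consensus_eq_card flip: I_def)
qed

section \<open>Maximizers of the consensus and the pruning loop\<close>

lemma argmax_consensus_iff:
  "(\<theta>, t) \<in> argmax_consensus \<epsilon> D \<longleftrightarrow> \<theta> \<in> {0..2 * pi} \<and>
     (\<forall>\<theta>' t'. \<theta>' \<in> {0..2 * pi} \<longrightarrow> consensus \<epsilon> D \<theta>' t' \<le> consensus \<epsilon> D \<theta> t)"
  by (auto simp: argmax_consensus_def is_arg_max_def not_less)

text \<open>No continuity or compactness is involved: the consensus is a natural number bounded by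
  \<open>card D\<close>, so a largest value is attained.\<close>

lemma argmax_consensus_nonempty:
  assumes "finite D"
  shows "argmax_consensus \<epsilon> D \<noteq> {}"
proof -
  let ?f = "\<lambda>(\<theta>, t). card (inliers \<epsilon> D \<theta> t)"
  have "?f y < Suc (card D)" for y
    using assms by (auto simp: inliers_def less_Suc_eq_le split: prod.split intro!: card_mono)
  then have "\<exists>x. fst x \<in> {0..2 * pi} \<and> (\<forall>y. fst y \<in> {0..2 * pi} \<longrightarrow> ?f y \<le> ?f x)"
    by (intro ex_has_greatest_nat[of _ "(0, 0)" _ "Suc (card D)"]) auto
  then obtain x where x: "fst x \<in> {0..2 * pi}" "\<And>y. fst y \<in> {0..2 * pi} \<Longrightarrow> ?f y \<le> ?f x"
    by blast
  have "(fst x, snd x) \<in> argmax_consensus \<epsilon> D"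
    unfolding argmax_consensus_iff consensus_eq_card[OF assms]
    using x(1) x(2)[of "(\<theta>', t')" for \<theta>' t'] by (auto simp: case_prod_unfold)
  then show ?thesis by blast
qed

lemma consensus_mono:
  assumes "D \<subseteq> D'" "finite D'"
  shows "consensus \<epsilon> D \<theta> t \<le> consensus \<epsilon> D' \<theta> t"
  unfolding consensus_def using assms by (intro sum_mono2) auto

text \<open>The invariant is relative to one fixed maximizer. \<open>E\<close> is overwritten at
  every step that does not prune and may decrease; what matters is that it is always 0 or a
  consensus of a subset of \<open>set C\<close> at an admissible angle, hence at most the
  optimum.\<close>

lemma fmp_fold_invariant:
  assumes sol: "\<forall>k<length C. solves_Q \<epsilon> C k (Eb k) (\<theta> k)"
    and opt: "(\<theta>s, ts) \<in> argmax_consensus \<epsilon> (set C)" and "n \<le> length C"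
  shows "case fold (fmp_step \<epsilon> C Eb \<theta>) [0..<n] (0, set C) of (E, D) \<Rightarrow>
    inliers \<epsilon> (set C) \<theta>s ts \<subseteq> D \<and> D \<subseteq> set C \<and> E \<le> consensus \<epsilon> (set C) \<theta>s ts"
  using assms(3)
proof (induction n)
  case 0
  then show ?case by (auto simp: inliers_def consensus_eq_card)
next
  case (Suc n)
  obtain E D where ED: "fold (fmp_step \<epsilon> C Eb \<theta>) [0..<n] (0, set C) = (E, D)"
    by fastforce
  then have step: "fold (fmp_step \<epsilon> C Eb \<theta>) [0..<Suc n] (0, set C) = fmp_step \<epsilon> C Eb \<theta> n (E, D)"
    by simp
  from ED Suc have IH: "inliers \<epsilon> (set C) \<theta>s ts \<subseteq> D" "D \<subseteq> set C" "E \<le> consensus \<epsilon> (set C) \<theta>s ts"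
    by auto
  have n: "is_arg_max (Q_obj \<epsilon> C n) (\<lambda>\<theta>. \<theta> \<in> {0..2 * pi}) (\<theta> n)" "Eb n = Q_obj \<epsilon> C n (\<theta> n)"
    using sol Suc.prems by (auto simp: solves_Q_def)
  have \<theta>s: "\<theta>s \<in> {0..2 * pi}" using opt by (simp add: argmax_consensus_iff)
  show ?case
  proof (cases "Eb n < E")
    case True
    have "C ! n \<notin> inliers \<epsilon> (set C) \<theta>s ts"
    proof
      assume "C ! n \<in> inliers \<epsilon> (set C) \<theta>s ts"
      then have "consensus \<epsilon> (set C) \<theta>s ts \<le> Q_obj \<epsilon> C n \<theta>s"
        using Suc.prems by (intro consensus_le_Q_obj) auto
      also have "\<dots> \<le> Eb n" using n \<theta>s by (auto simp: is_arg_max_def not_less)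
      finally show False using True IH(3) by simp
    qed
    then show ?thesis using True IH unfolding step by (auto simp: fmp_step_def)
  next
    case False
    have "consensus \<epsilon> D (\<theta> n) t \<le> consensus \<epsilon> (set C) \<theta>s ts" for t
    proof -
      have "consensus \<epsilon> D (\<theta> n) t \<le> consensus \<epsilon> (set C) (\<theta> n) t"
        using IH(2) by (intro consensus_mono) auto
      also have "\<dots> \<le> consensus \<epsilon> (set C) \<theta>s ts"
        using opt n(1) by (simp add: argmax_consensus_iff is_arg_max_def)
      finally show ?thesis .
    qed
    then show ?thesis using False IH unfolding step by (simp add: fmp_step_def)
  qed
qed

lemma fmp_subset: "fmp \<epsilon> C Eb \<theta> \<subseteq> set C"
proof -
  have "snd (fold (fmp_step \<epsilon> C Eb \<theta>) ks ED) \<subseteq> snd ED" for ks ED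
    by (induction ks arbitrary: ED) (force simp: fmp_step_def split: prod.splits if_splits)+
  from this[of "[0..<length C]" "(0, set C)"] show ?thesis
    by (auto simp: fmp_def Let_def split: prod.splits)
qed

text \<open>The closing pass repeats the pruning test with the final \<open>E\<close>, so the same
  chain of inequalities applies. It is shown for every index \<open>k\<close> that carries an
  inlier, because one failing index would remove a repeated match.\<close>

lemma inliers_subset_fmp:
  assumes sol: "\<forall>k<length C. solves_Q \<epsilon> C k (Eb k) (\<theta> k)"
    and opt: "(\<theta>s, ts) \<in> argmax_consensus \<epsilon> (set C)"
  shows "inliers \<epsilon> (set C) \<theta>s ts \<subseteq> fmp \<epsilon> C Eb \<theta>"
proof -
  obtain E D where ED: "fold (fmp_step \<epsilon> C Eb \<theta>) [0..<length C] (0, set C) = (E, D)"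
    by fastforce
  have inv: "inliers \<epsilon> (set C) \<theta>s ts \<subseteq> D" "E \<le> consensus \<epsilon> (set C) \<theta>s ts"
    using fmp_fold_invariant[OF sol opt order.refl] by (auto simp: ED)
  have "E \<le> Eb k" if "C ! k \<in> inliers \<epsilon> (set C) \<theta>s ts" "k < length C" for k
  proof -
    note inv(2)
    also have "consensus \<epsilon> (set C) \<theta>s ts \<le> Q_obj \<epsilon> C k \<theta>s"
      using that by (intro consensus_le_Q_obj)
    also have "\<dots> \<le> Eb k"
      using sol that opt by (auto simp: solves_Q_def is_arg_max_def not_less argmax_consensus_iff)
    finally show ?thesis .
  qed
  then show ?thesis using inv(1) by (fastforce simp: fmp_def ED)
qed

text \<open>At a maximizer for \<open>D\<close> no inlier is lost, so both consensus values agree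
  there; elsewhere passing to \<open>D'\<close> can only lower the value. Hence the maximal values
  coincide. The inclusion from right to left compares with an existing maximizer for
  \<open>D\<close>.\<close>

lemma argmax_consensus_eq:
  assumes "finite D" "D' \<subseteq> D"
    and inl: "\<And>\<theta> t. (\<theta>, t) \<in> argmax_consensus \<epsilon> D \<Longrightarrow> inliers \<epsilon> D \<theta> t \<subseteq> D'"
  shows "argmax_consensus \<epsilon> D = argmax_consensus \<epsilon> D'"
proof -
  have fin: "finite D'" using assms finite_subset by blast
  have eq: "consensus \<epsilon> D' \<theta> t = consensus \<epsilon> D \<theta> t" if "(\<theta>, t) \<in> argmax_consensus \<epsilon> D" for \<theta> t
  proof -
    have "inliers \<epsilon> D' \<theta> t = inliers \<epsilon> D \<theta> t"
      using inl[OF that] assms(2) by (auto simp: inliers_def)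
    then show ?thesis by (simp add: consensus_eq_card fin assms(1))
  qed
  have le: "consensus \<epsilon> D' \<theta> t \<le> consensus \<epsilon> D \<theta> t" for \<theta> t
    using assms by (intro consensus_mono)
  obtain \<theta>0 t0 where opt: "(\<theta>0, t0) \<in> argmax_consensus \<epsilon> D"
    using argmax_consensus_nonempty[OF assms(1), of \<epsilon>] by auto
  have "(\<theta>, t) \<in> argmax_consensus \<epsilon> D \<longleftrightarrow> (\<theta>, t) \<in> argmax_consensus \<epsilon> D'" for \<theta> t
  proof
    assume x: "(\<theta>, t) \<in> argmax_consensus \<epsilon> D"
    show "(\<theta>, t) \<in> argmax_consensus \<epsilon> D'"
      using x eq[OF x] unfolding argmax_consensus_iff by (auto intro: order.trans[OF le])
  next
    assume x: "(\<theta>, t) \<in> argmax_consensus \<epsilon> D'"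
    have "consensus \<epsilon> D' \<theta>0 t0 \<le> consensus \<epsilon> D' \<theta> t"
      using x opt unfolding argmax_consensus_iff by blast
    then have "consensus \<epsilon> D \<theta>0 t0 \<le> consensus \<epsilon> D' \<theta> t"
      by (simp only: eq[OF opt])
    also note le
    finally show "(\<theta>, t) \<in> argmax_consensus \<epsilon> D"
      using opt x unfolding argmax_consensus_iff by (auto intro: order.trans)
  qed
  then show ?thesis by auto
qed

section \<open>Reasoning about unit-cost programs\<close>

text \<open>A total-correctness triple with a cost bound. Demanding a single outcome puts
  determinism and termination into the same judgement as correctness and running time.\<close>

definition spec :: "'a comp \<Rightarrow> nat \<Rightarrow> ('a \<Rightarrow> bool) \<Rightarrow> bool" where
  "spec m b P \<longleftrightarrow> (\<exists>x n. outcomes m = {(x, n)} \<and> n \<le> b \<and> P x)"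

lemma spec_ret [simp]: "spec (ret x) b P \<longleftrightarrow> P x"
  by (auto simp: spec_def ret_def)

lemma spec_op [simp]: "spec (op x) b P \<longleftrightarrow> 1 \<le> b \<and> P x"
  by (auto simp: spec_def)

lemma spec_bind:
  assumes "spec m a P" and "\<And>x. P x \<Longrightarrow> spec (f x) b Q" and "a + b \<le> c"
  shows "spec (bind_comp m f) c Q"
proof -
  obtain x n where x: "outcomes m = {(x, n)}" "n \<le> a" "P x"
    using assms(1) by (auto simp: spec_def)
  obtain y n' where y: "outcomes (f x) = {(y, n')}" "n' \<le> b" "Q y"
    using assms(2)[OF x(3)] by (auto simp: spec_def)
  have "outcomes (bind_comp m f) = {(y, n + n')}"
    using x y by (auto simp: bind_comp_def)
  then show ?thesis
    using x y assms(3) by (auto simp: spec_def)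
qed

text \<open>For subprograms with an exactly known result \<open>v\<close>. Writing the remaining
  budget as \<open>c - a\<close> leaves the cost arithmetic to the simplifier;
  \<open>a \<le> c\<close> keeps the truncated subtraction exact.\<close>

lemma spec_bind_eq:
  assumes "spec m a ((=) v)" and "a \<le> c" and "spec (f v) (c - a) Q"
  shows "spec (bind_comp m f) c Q"
  using assms by (intro spec_bind[OF assms(1)]) auto

text \<open>An equivalence, so that straight-line code is executed by rewriting, one unit per
  \<open>op\<close>. Prefixing \<open>op x\<close> adds 1 to the cost of each outcome of
  \<open>f x\<close> and changes nothing else, so uniqueness of the outcome passes in both
  directions.\<close>

lemma spec_op_bind [simp]: "spec (bind_comp (op x) f) b Q \<longleftrightarrow> 1 \<le> b \<and> spec (f x) (b - 1) Q"
proof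
  assume "1 \<le> b \<and> spec (f x) (b - 1) Q"
  then show "spec (bind_comp (op x) f) b Q"
    by (intro spec_bind_eq[where v = x and a = 1]) auto
next
  assume "spec (bind_comp (op x) f) b Q"
  then obtain y n where y: "outcomes (bind_comp (op x) f) = {(y, n)}" "n \<le> b" "Q y"
    unfolding spec_def by blast
  have "(z, Suc m) \<in> outcomes (bind_comp (op x) f)" if "(z, m) \<in> outcomes (f x)" for z m
    using that by (simp add: bind_comp_def)
  then have sub: "z = y \<and> Suc m = n" if "(z, m) \<in> outcomes (f x)" for z m
    using that unfolding y(1) by blast
  have "(y, n) \<in> outcomes (bind_comp (op x) f)"
    unfolding y(1) by simp
  then obtain n' where n: "n = Suc n'" "(y, n') \<in> outcomes (f x)"
    by (auto simp: bind_comp_def)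
  have "outcomes (f x) = {(y, n')}"
  proof (rule set_eqI)
    fix z
    show "z \<in> outcomes (f x) \<longleftrightarrow> z \<in> {(y, n')}"
      using sub[of "fst z" "snd z"] n by (cases z) auto
  qed
  moreover have "1 \<le> b" "n' \<le> b - 1"
    using y(2) n(1) by simp_all
  ultimately show "1 \<le> b \<and> spec (f x) (b - 1) Q"
    using y(3) unfolding spec_def by blast
qed

lemma bind_ret [simp]: "bind_comp (ret x) f = f x"
proof -
  have "outcomes (bind_comp (ret x) f) = outcomes (f x)"
    by (auto simp: bind_comp_def ret_def)
  then show ?thesis by (rule comp.expand)
qed

lemma spec_weaken:
  assumes "spec m a P" "a \<le> b" "\<And>x. P x \<Longrightarrow> Q x"
  shows "spec m b Q"
  using assms by (auto simp: spec_def intro: order_trans)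

section \<open>Vector arithmetic, rotations and lists of matches\<close>

lemma vec3_eq_iff: "a = b \<longleftrightarrow> a $ 1 = b $ 1 \<and> a $ 2 = b $ 2 \<and> a $ 3 = b $ 3" for a b :: "'a^3"
  by (auto simp: vec_eq_iff forall_3)

lemma add_prog_spec: "spec (add_prog a b) 3 ((=) (a + b))"
  by (simp add: add_prog_def vec3_eq_iff)

lemma sub_prog_spec: "spec (sub_prog a b) 3 ((=) (a - b))"
  by (simp add: sub_prog_def vec3_eq_iff)

lemma norm_vec3: "norm a = sqrt (a $ 1 * a $ 1 + a $ 2 * a $ 2 + a $ 3 * a $ 3)" for a :: "real^3"
  by (simp add: norm_eq_sqrt_inner inner_vec_def sum_3)

lemma sqnorm_prog_spec: "spec (sqnorm_prog a) 5 ((=) (norm a ^ 2))"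
  by (simp add: sqnorm_prog_def norm_vec3 real_sqrt_pow2)

lemma Rot_mult:
  "(Rot \<theta> *v a) $ 1 = cos \<theta> * a $ 1 + sin \<theta> * a $ 2"
  "(Rot \<theta> *v a) $ 2 = cos \<theta> * a $ 2 - sin \<theta> * a $ 1"
  "(Rot \<theta> *v a) $ 3 = a $ 3"
  by (simp_all add: Rot_def matrix_vector_mult_def sum_3)

lemma rot_prog_spec: "spec (rot_prog \<theta> a) 8 ((=) (Rot \<theta> *v a))"
  by (simp add: rot_prog_def vec3_eq_iff Rot_mult)

lemma eq_point_prog_spec: "spec (eq_point_prog a b) 3 ((=) (a = b))"
  by (simp add: eq_point_prog_def vec3_eq_iff)

text \<open>The program counts list entries; \<open>distinct D\<close> turns this into a sum over a
  set. The 23 units per entry are: tick 1, rotation 8, addition and subtraction 3 each, squared norm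
  5, square root, comparison and increment 1 each.\<close>

lemma consensus_prog_spec:
  assumes "distinct D"
  shows "spec (consensus_prog \<epsilon> D \<theta> t) (23 * length D + 1) ((=) (consensus \<epsilon> (set D) \<theta> t))"
  using assms
proof (induction \<epsilon> D \<theta> t rule: consensus_prog.induct)
  case (1 \<epsilon> \<theta> t)
  then show ?case by (simp add: consensus_def)
next
  case (2 \<epsilon> p q D \<theta> t)
  have IH: "spec (consensus_prog \<epsilon> D \<theta> t) (23 * length D + 1) ((=) (consensus \<epsilon> (set D) \<theta> t))"
    and notin: "(p, q) \<notin> set D"
    using 2 by auto
  show ?case
    using notin
    by (auto intro!: spec_bind[OF IH, where b = 22] spec_bind_eq[OF rot_prog_spec] spec_bind_eq[OF add_prog_spec]
        spec_bind_eq[OF sub_prog_spec] spec_bind_eq[OF sqnorm_prog_spec] simp: consensus_def)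
qed

lemma remove_prog_spec:
  "spec (remove_prog m D) (7 * length D + 1) ((=) (removeAll m D))"
proof (induction m D rule: remove_prog.induct)
  case (2 m m' D)
  show ?case
    by (auto intro!: spec_bind[OF 2, where b = 6] spec_bind_eq[OF eq_point_prog_spec] simp: prod_eq_iff)
qed auto

text \<open>Quadratic cost is affordable, being below the target \<open>M^2 log M\<close>. The
  deduplicated tail is no longer than the tail, which bounds the cost of each removal.\<close>

lemma to_set_prog_spec:
  "spec (to_set_prog C) (length C * (7 * length C + 2) + 1)
    (\<lambda>D. distinct D \<and> set D = set C \<and> length D \<le> length C)"
proof (induction C rule: to_set_prog.induct)
  case (2 m C)
  have step: "spec (bind_comp (remove_prog m D) (\<lambda>D'. ret (m # D'))) (7 * length C + 1)
      (\<lambda>D. distinct D \<and> set D = set (m # C) \<and> length D \<le> length (m # C))"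
    if "distinct D \<and> set D = set C \<and> length D \<le> length C" for D
    using that
    by (intro spec_bind_eq[OF remove_prog_spec])
      (auto simp: distinct_removeAll intro: le_trans[OF length_removeAll_less_eq])
  have IH: "spec (to_set_prog C) (length C * (7 * length C + 2) + 1)
      (\<lambda>D. distinct D \<and> set D = set C \<and> length D \<le> length C)"
    using 2 by simp
  have "length C * (7 * length C + 2) + 1 + (7 * length C + 1) \<le> length (m # C) * (7 * length (m # C) + 2) + 1 - 1"
    by (simp add: algebra_simps)
  from spec_bind[OF IH step this] show ?case
    by (simp del: set_simps)
qed auto

section \<open>Sorting and sweeping\<close>

lemma length_prog_spec: "spec (length_prog xs) (2 * length xs + 1) ((=) (length xs))"
proof (induction xs)
  case (Cons x xs)
  then show ?case by (auto intro!: spec_bind_eq[OF Cons])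
qed auto

lemma merge_prog_spec:
  assumes "sorted xs" "sorted ys"
  shows "spec (merge_prog xs ys) (2 * (length xs + length ys) + 1) (\<lambda>zs. sorted zs \<and> mset zs = mset xs + mset ys)"
  using assms
proof (induction xs ys rule: merge_prog.induct)
  case (3 x xs y ys)
  show ?case
  proof (cases "x \<le> y")
    case True
    have "spec (merge_prog xs (y # ys)) (2 * (length xs + length (y # ys)) + 1)
      (\<lambda>zs. sorted zs \<and> mset zs = mset xs + mset (y # ys))"
      using 3 True by auto
    moreover have "\<forall>z\<in>set zs. x \<le> z" if "mset zs = mset xs + mset (y # ys)" for zs
    proof -
      have "set zs = set xs \<union> set (y # ys)" using that by (metis set_mset_mset set_mset_union)
      then show ?thesis using 3(3,4) True by auto
    qed
    ultimately show ?thesis using True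
      by (auto intro!: spec_bind[where b = 0])
  next
    case False
    have "spec (merge_prog (x # xs) ys) (2 * (length (x # xs) + length ys) + 1)
      (\<lambda>zs. sorted zs \<and> mset zs = mset (x # xs) + mset ys)"
      using 3 False by auto
    moreover have "\<forall>z\<in>set zs. y \<le> z" if "mset zs = mset (x # xs) + mset ys" for zs
    proof -
      have "set zs = set (x # xs) \<union> set ys" using that by (metis set_mset_mset set_mset_union)
      then show ?thesis using 3(3,4) False by auto
    qed
    ultimately show ?thesis using False
      by (auto intro!: spec_bind[where b = 0])
  qed
qed auto

declare msort_prog.simps [simp del]

text \<open>The summand \<open>- 5\<close> absorbs the \<open>2 * n + 5\<close> units that one call spends outside its recursive calls.\<close>

lemma msort_prog_spec:
  assumes "n \<le> 2 ^ d" "n \<le> length xs" "1 \<le> n"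
  shows "spec (msort_prog n xs) (2 * n * d + 8 * n - 5)
    (\<lambda>(ys, zs). sorted ys \<and> mset ys = mset (take n xs) \<and> zs = drop n xs)"
  using assms
proof (induction d arbitrary: n xs)
  case 0
  then have [simp]: "n = 1" by simp
  show ?case
    by (subst msort_prog.simps) (use 0 in \<open>cases xs; auto\<close>)
next
  case (Suc d)
  show ?case
  proof (cases "n = 1")
    case True
    then show ?thesis
      by (subst msort_prog.simps) (use Suc in \<open>cases xs; auto\<close>)
  next
    case False
    define n1 n2 where "n1 = n div 2" and "n2 = n - n1"
    \<comment> \<open>\<open>n2\<close> is the half rounded up; it still fits below
      \<open>2 ^ d\<close> because the bound \<open>2 ^ Suc d\<close> on \<open>n\<close> is
      even.\<close>
    have n: "n1 + n2 = n" "1 \<le> n1" "1 \<le> n2" "n1 \<le> 2 ^ d" "n2 \<le> 2 ^ d"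
      using False Suc.prems by (auto simp: n1_def n2_def)
    have s1: "spec (msort_prog n1 xs) (2 * n1 * d + 8 * n1 - 5)
       (\<lambda>(ys, zs). sorted ys \<and> mset ys = mset (take n1 xs) \<and> zs = drop n1 xs)"
      using Suc.prems n by (intro Suc.IH) auto
    have s2: "spec (msort_prog n2 (drop n1 xs)) (2 * n2 * d + 8 * n2 - 5)
       (\<lambda>(ys, zs). sorted ys \<and> mset ys = mset (take n2 (drop n1 xs)) \<and> zs = drop n2 (drop n1 xs))"
      using Suc.prems n by (intro Suc.IH) auto
    have s3: "spec (bind_comp (merge_prog as bs) (\<lambda>cs. ret (cs, drop n2 (drop n1 xs)))) (2 * n + 1)
        (\<lambda>(ys, zs). sorted ys \<and> mset ys = mset (take n xs) \<and> zs = drop n xs)"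
      if "sorted as" "sorted bs" "mset as = mset (take n1 xs)" "mset bs = mset (take n2 (drop n1 xs))" for as bs
    proof -
      have "length as = n1" "length bs = n2"
        using that n Suc.prems by (auto dest!: mset_eq_length)
      moreover have "mset (take n1 xs) + mset (take n2 (drop n1 xs)) = mset (take n xs)"
        by (simp add: n(1)[symmetric] take_add)
      ultimately show ?thesis
        using that n by (intro spec_bind[OF merge_prog_spec[OF that(1,2)], where b = 0]) (auto simp: add.commute)
    qed
    \<comment> \<open>The 4 is the tick, the size test and the computation of \<open>n1\<close> and
      \<open>n2\<close>. As both are positive, no subtraction of 5 is cut off at zero.\<close>
    have c: "2 * n1 * d + 8 * n1 - 5 + (2 * n2 * d + 8 * n2 - 5 + (2 * n + 1)) + 4 \<le> 2 * n * Suc d + 8 * n - 5"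
      using n(2,3) by (simp add: n(1)[symmetric] algebra_simps)
    show ?thesis
      using False Suc.prems c
      by (subst msort_prog.simps)
        (auto simp flip: n1_def n2_def intro!: spec_bind[OF s1] spec_bind[OF s2] s3)
  qed
qed

lemma sort_prog_spec:
  assumes "length xs \<le> 2 ^ d"
  shows "spec (sort_prog xs) (2 * length xs * d + 10 * length xs + 4) (\<lambda>ys. sorted ys \<and> mset ys = mset xs)"
\<comment> \<open>The bound for merge sort starts at length 1, so the empty list is run directly: 3
  units for sorting and 1 for the length give the summand 4.\<close>
proof (cases "xs = []")
  case True
  moreover have "spec (msort_prog 0 []) 3 ((=) ([], []))"
    by (subst msort_prog.simps) simp
  ultimately show ?thesis
    unfolding sort_prog_def
    by (intro spec_bind_eq[OF length_prog_spec])
      (auto intro: spec_bind_eq)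
next
  case False
  then have "1 \<le> length xs" by (cases xs) auto
  have "spec (bind_comp (msort_prog (length xs) xs) (\<lambda>(ys, _). ret ys)) (2 * length xs * d + 8 * length xs - 5 + 0)
     (\<lambda>ys. sorted ys \<and> mset ys = mset xs)"
    by (rule spec_bind[OF msort_prog_spec[OF assms order.refl \<open>1 \<le> _\<close>] _ order.refl]) auto
  then show ?thesis
    unfolding sort_prog_def
    by (intro spec_bind_eq[OF length_prog_spec]) (auto elim!: spec_weaken)
qed

section \<open>Counting the intervals above a point, and the sweep\<close>

definition covers :: "(real \<times> real) list \<Rightarrow> real \<Rightarrow> nat" where
  "covers iv x = length (filter (\<lambda>(l, r). l \<le> x \<and> x \<le> r) iv)"

text \<open>Intervals opened up to \<open>x\<close> minus intervals closed before \<open>x\<close>;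
  strictness keeps a closed interval open at its right endpoint. Only the multisets of endpoints
  matter, so both lists can be sorted independently although this destroys the pairing.\<close>

definition balance :: "real list \<Rightarrow> real list \<Rightarrow> real \<Rightarrow> real" where
  "balance ls rs x = real (length (filter (\<lambda>l. l \<le> x) ls)) - real (length (filter (\<lambda>r. r < x) rs))"

text \<open>By \<open>l \<le> r\<close>, an interval closed before \<open>x\<close> was also opened
  before \<open>x\<close>, so its two contributions cancel.\<close>

lemma balance_eq_covers:
  assumes "\<forall>(l, r)\<in>set iv. l \<le> r"
  shows "balance (map fst iv) (map snd iv) x = real (covers iv x)"
  using assms by (induction iv) (auto simp: balance_def covers_def)

lemma balance_cong_mset:
  assumes "mset ls = mset ls'" "mset rs = mset rs'"
  shows "balance ls rs = balance ls' rs'"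
proof -
  have eq: "length (filter P xs) = length (filter P ys)" if "mset xs = mset ys" for P and xs ys :: "real list"
    by (metis that mset_filter size_mset)
  show ?thesis
    by (intro ext) (simp add: balance_def eq[OF assms(1)] eq[OF assms(2)])
qed

text \<open>With repeated left endpoints, the counter equals the balance only when the last copy is processed;
  before that it is smaller, so recording a point too early does no harm.\<close>

lemma sweep_prog_spec:
  assumes "sorted ls" "sorted rs" "\<forall>l\<in>set ls. \<exists>r\<in>set rs. l \<le> r"
  shows "spec (sweep_prog ls rs n best \<theta>) (4 * (length ls + length rs) + 1)
    (\<lambda>(b, t). best \<le> b \<and> (\<forall>x\<in>set ls. n + balance ls rs x \<le> b) \<and>
       (b = best \<and> t = \<theta> \<or> t \<in> set ls \<and> b \<le> n + balance ls rs t))"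
  using assms
proof (induction "length ls + length rs" arbitrary: ls rs n best \<theta> rule: less_induct)
  case (less ls0 rs0)
  show ?case
  proof (cases ls0)
    case Nil
    then show ?thesis by simp
  next
    case (Cons l ls)
    \<comment> \<open>A pending left endpoint has a pending right endpoint at or beyond it, so the
      right endpoints are never exhausted first.\<close>
    with less.prems(3) obtain r rs where eq: "ls0 = l # ls" "rs0 = r # rs"
      by (cases rs0) auto
    note srt = less.prems[unfolded eq]
    note IH = less.hyps[unfolded eq]
    show ?thesis
    proof (cases "l \<le> r")
      case True
      have no_r: "filter (\<lambda>r. r < l) (r # rs) = []"
        using True srt(2) by (force simp: filter_empty_conv)
      have bal: "balance (l # ls) (r # rs) x = 1 + balance ls (r # rs) x" if "l \<le> x" for x
        using that by (simp add: balance_def)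
      have ge: "l \<le> x" if "x \<in> set ls" for x
        using srt(1) that by auto
      have bal_l: "balance (l # ls) (r # rs) l = 1 + real (length (filter (\<lambda>x. x \<le> l) ls))"
        using no_r by (simp add: balance_def)
      \<comment> \<open>Either another copy of \<open>l\<close> follows and the induction hypothesis
        covers it, or this is the last copy and the balance at \<open>l\<close> is 1, so the
        incremented counter is exact.\<close>
      have eq_l: "l \<in> set ls \<or> filter (\<lambda>x. x \<le> l) ls = []"
        using ge by (force simp: filter_empty_conv)
      define best' \<theta>' where "best' = (if best < n + 1 then n + 1 else best)" and "\<theta>' = (if best < n + 1 then l else \<theta>)"
      have s: "spec (sweep_prog ls (r # rs) (n + 1) best' \<theta>') (4 * (length ls + length (r # rs)) + 1)
        (\<lambda>(b, t). best' \<le> b \<and> (\<forall>x\<in>set ls. n + 1 + balance ls (r # rs) x \<le> b) \<and>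
         (b = best' \<and> t = \<theta>' \<or> t \<in> set ls \<and> b \<le> n + 1 + balance ls (r # rs) t))"
        using srt by (intro IH) auto
      have conv: "best \<le> b \<and> (\<forall>x\<in>set (l # ls). n + balance (l # ls) (r # rs) x \<le> b) \<and>
         (b = best \<and> t = \<theta> \<or> t \<in> set (l # ls) \<and> b \<le> n + balance (l # ls) (r # rs) t)"
        if "best' \<le> b" and le: "\<forall>x\<in>set ls. n + 1 + balance ls (r # rs) x \<le> b" and
         at: "b = best' \<and> t = \<theta>' \<or> t \<in> set ls \<and> b \<le> n + 1 + balance ls (r # rs) t" for b t
      proof (intro conjI ballI)
        have best: "best \<le> best'" "n + 1 \<le> best'" by (auto simp: best'_def)
        show "best \<le> b" using best that(1) by linarith
        show "n + balance (l # ls) (r # rs) x \<le> b" if "x \<in> set (l # ls)" for x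
        proof (cases "x \<in> set ls")
          case True
          then show ?thesis using le bal[OF ge[OF True]] by auto
        next
          case False
          then have "x = l" using that by auto
          then show ?thesis using False bal_l eq_l best \<open>best' \<le> b\<close> by auto
        qed
        show "b = best \<and> t = \<theta> \<or> t \<in> set (l # ls) \<and> b \<le> n + balance (l # ls) (r # rs) t"
          using at
        proof
          assume "b = best' \<and> t = \<theta>'"
          then show ?thesis using bal_l by (auto simp: best'_def \<theta>'_def)
        next
          assume "t \<in> set ls \<and> b \<le> n + 1 + balance ls (r # rs) t"
          then show ?thesis using bal[of t] ge by auto
        qed
      qed
      have "spec (sweep_prog ls (r # rs) (n + 1) best' \<theta>') (4 * (length ls + length (r # rs)) + 1)
        (\<lambda>(b, t). best \<le> b \<and> (\<forall>x\<in>set (l # ls). n + balance (l # ls) (r # rs) x \<le> b) \<and>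
         (b = best \<and> t = \<theta> \<or> t \<in> set (l # ls) \<and> b \<le> n + balance (l # ls) (r # rs) t))"
      proof (rule spec_weaken[OF s order.refl])
        fix z assume "case z of (b, t) \<Rightarrow> best' \<le> b \<and> (\<forall>x\<in>set ls. n + 1 + balance ls (r # rs) x \<le> b) \<and>
          (b = best' \<and> t = \<theta>' \<or> t \<in> set ls \<and> b \<le> n + 1 + balance ls (r # rs) t)"
        then show "case z of (b, t) \<Rightarrow> best \<le> b \<and> (\<forall>x\<in>set (l # ls). n + balance (l # ls) (r # rs) x \<le> b) \<and>
          (b = best \<and> t = \<theta> \<or> t \<in> set (l # ls) \<and> b \<le> n + balance (l # ls) (r # rs) t)"
          by (cases z) (simp only: prod.case, elim conjE, rule conv; assumption)
      qed
      then have "spec (sweep_prog ls (r # rs) (n + 1) best' \<theta>') (4 * (length (l # ls) + length (r # rs)) + 1 - 4)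
        (\<lambda>(b, t). best \<le> b \<and> (\<forall>x\<in>set (l # ls). n + balance (l # ls) (r # rs) x \<le> b) \<and>
         (b = best \<and> t = \<theta> \<or> t \<in> set (l # ls) \<and> b \<le> n + balance (l # ls) (r # rs) t))"
        by (rule spec_weaken) simp_all
      then show ?thesis
        unfolding eq using True by (cases "best < n + 1") (simp_all add: best'_def \<theta>'_def del: set_simps)
    next
      case False
      \<comment> \<open>Here \<open>r < l\<close> and \<open>l\<close> is the least remaining left
        endpoint, so \<open>r\<close> counts as closed at every remaining left endpoint; this
        matches the decrement of \<open>n\<close>.\<close>
      have bal: "balance (l # ls) (r # rs) x = balance (l # ls) rs x - 1" if "x \<in> set (l # ls)" for x
        using that False srt(1) by (auto simp: balance_def)
      have "\<forall>l'\<in>set (l # ls). \<exists>r\<in>set rs. l' \<le> r"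
        using srt(1,3) False by fastforce
      with srt have "spec (sweep_prog (l # ls) rs (n - 1) best \<theta>) (4 * (length (l # ls) + length rs) + 1)
        (\<lambda>(b, t). best \<le> b \<and> (\<forall>x\<in>set (l # ls). n - 1 + balance (l # ls) rs x \<le> b) \<and>
         (b = best \<and> t = \<theta> \<or> t \<in> set (l # ls) \<and> b \<le> n - 1 + balance (l # ls) rs t))"
        by (intro IH) auto
      then have "spec (sweep_prog (l # ls) rs (n - 1) best \<theta>) (4 * (length (l # ls) + length rs) + 1)
        (\<lambda>(b, t). best \<le> b \<and> (\<forall>x\<in>set (l # ls). n + balance (l # ls) (r # rs) x \<le> b) \<and>
         (b = best \<and> t = \<theta> \<or> t \<in> set (l # ls) \<and> b \<le> n + balance (l # ls) (r # rs) t))"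
        by (rule spec_weaken) (auto simp: bal)
      then have "spec (sweep_prog (l # ls) rs (n - 1) best \<theta>) (4 * (length (l # ls) + length (r # rs)) + 1 - 3)
        (\<lambda>(b, t). best \<le> b \<and> (\<forall>x\<in>set (l # ls). n + balance (l # ls) (r # rs) x \<le> b) \<and>
         (b = best \<and> t = \<theta> \<or> t \<in> set (l # ls) \<and> b \<le> n + balance (l # ls) (r # rs) t))"
        by (rule spec_weaken) simp_all
      then show ?thesis
        unfolding eq using False by (simp del: set_simps)
    qed
  qed
qed

section \<open>Trigonometry: compatible angles as arcs of the circle\<close>

section \<open>Solving \<open>Q[k]\<close>\<close>

text \<open>The trace on \<open>[0, 2 * pi]\<close> of the arc with centre \<open>\<phi>\<close> and
  half-width \<open>\<alpha>\<close>. The tests are non-strict because 0 and \<open>2 * pi\<close>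
  are the same rotation: an arc that just touches one end also contributes the other, as a one-point
  interval.\<close>

definition arcs_of :: "real \<Rightarrow> real \<Rightarrow> (real \<times> real) list" where
  "arcs_of \<phi> \<alpha> =
     (if \<phi> - \<alpha> \<le> 0 then [(0, \<phi> + \<alpha>), (\<phi> - \<alpha> + 2 * pi, 2 * pi)]
      else if 2 * pi \<le> \<phi> + \<alpha> then [(\<phi> - \<alpha>, 2 * pi), (0, \<phi> + \<alpha> - 2 * pi)]
      else [(\<phi> - \<alpha>, \<phi> + \<alpha>)])"

text \<open>The distance of \<open>x\<close> and \<open>\<phi>\<close> lies in
  \<open>[0, 2 * pi]\<close>; there the cosine decreases up to \<open>pi\<close> and is symmetric
  about \<open>pi\<close>.\<close>

lemma cos_diff_ge_iff:
  assumes "\<phi> \<in> {0..2 * pi}" "x \<in> {0..2 * pi}" "0 \<le> \<alpha>" "\<alpha> < pi"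
  shows "cos \<alpha> \<le> cos (x - \<phi>) \<longleftrightarrow> \<bar>x - \<phi>\<bar> \<le> \<alpha> \<or> 2 * pi - \<alpha> \<le> \<bar>x - \<phi>\<bar>"
proof -
  define y where "y = \<bar>x - \<phi>\<bar>"
  have y: "0 \<le> y" "y \<le> 2 * pi" "cos (x - \<phi>) = cos y"
    using assms by (auto simp: y_def)
  have "cos \<alpha> \<le> cos y \<longleftrightarrow> y \<le> \<alpha> \<or> 2 * pi - \<alpha> \<le> y"
  proof (cases "y \<le> pi")
    case True
    have "cos \<alpha> \<le> cos y \<longleftrightarrow> y \<le> \<alpha>"
      by (rule cos_mono_le_eq) (use y(1) assms(3,4) True in linarith)+
    then show ?thesis using True assms(4) by linarith
  next
    case False
    have "cos y = cos (2 * pi - y)" by (simp add: cos_diff)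
    moreover have "cos \<alpha> \<le> cos (2 * pi - y) \<longleftrightarrow> 2 * pi - y \<le> \<alpha>"
      by (rule cos_mono_le_eq) (use y(2) assms(3,4) False in linarith)+
    ultimately show ?thesis using False assms(4) by auto
  qed
  then show ?thesis by (simp only: y(3) flip: y_def)
qed

definition angle_intervals :: "(real \<times> real) list \<Rightarrow> bool" where
  "angle_intervals iv \<longleftrightarrow> (\<forall>(l, r)\<in>set iv. 0 \<le> l \<and> l \<le> r \<and> r \<le> 2 * pi)"

text \<open>\<open>\<alpha> < pi\<close> keeps the two pieces of a wrapped arc disjoint, so that a
  match is never counted twice at one angle.\<close>

lemma arcs_of_correct:
  assumes "\<phi> \<in> {0..2 * pi}" "0 \<le> \<alpha>" "\<alpha> < pi"
  shows "angle_intervals (arcs_of \<phi> \<alpha>)"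
    and "x \<in> {0..2 * pi} \<Longrightarrow> covers (arcs_of \<phi> \<alpha>) x = of_bool (cos \<alpha> \<le> cos (x - \<phi>))"
proof -
  show "angle_intervals (arcs_of \<phi> \<alpha>)"
    using assms by (simp add: arcs_of_def angle_intervals_def)
  assume x: "x \<in> {0..2 * pi}"
  have b: "0 \<le> \<phi>" "\<phi> \<le> 2 * pi" "0 \<le> x" "x \<le> 2 * pi"
    using assms(1) x by auto
  note iff = cos_diff_ge_iff[OF assms(1) x assms(2,3)]
  consider "\<phi> - \<alpha> \<le> 0" | "0 < \<phi> - \<alpha>" "2 * pi \<le> \<phi> + \<alpha>" | "0 < \<phi> - \<alpha>" "\<phi> + \<alpha> < 2 * pi"
    by linarith
  then show "covers (arcs_of \<phi> \<alpha>) x = of_bool (cos \<alpha> \<le> cos (x - \<phi>))"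
  proof cases
    case 1
    have "cos \<alpha> \<le> cos (x - \<phi>) \<longleftrightarrow> x \<le> \<phi> + \<alpha> \<or> \<phi> - \<alpha> + 2 * pi \<le> x"
      unfolding iff using b 1 assms by linarith
    moreover have "\<not> (x \<le> \<phi> + \<alpha> \<and> \<phi> - \<alpha> + 2 * pi \<le> x)"
      using assms(3) by linarith
    ultimately show ?thesis
      using b 1 by (cases "x \<le> \<phi> + \<alpha>") (simp_all add: arcs_of_def covers_def)
  next
    case 2
    have "cos \<alpha> \<le> cos (x - \<phi>) \<longleftrightarrow> \<phi> - \<alpha> \<le> x \<or> x \<le> \<phi> + \<alpha> - 2 * pi"
      unfolding iff using b 2 assms by linarith
    moreover have "\<not> (\<phi> - \<alpha> \<le> x \<and> x \<le> \<phi> + \<alpha> - 2 * pi)"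
      using assms(3) by linarith
    ultimately show ?thesis
      using b 2 by (cases "\<phi> - \<alpha> \<le> x") (simp_all add: arcs_of_def covers_def)
  next
    case 3
    have "cos \<alpha> \<le> cos (x - \<phi>) \<longleftrightarrow> \<phi> - \<alpha> \<le> x \<and> x \<le> \<phi> + \<alpha>"
      unfolding iff using b 3 assms by linarith
    then show ?thesis
      using b 3 by (simp add: arcs_of_def covers_def)
  qed
qed

text \<open>\<open>arccos\<close> recovers the angle only in the upper half plane, where the sine is
  nonnegative; for \<open>v < 0\<close> the angle is reflected.\<close>

lemma polar:
  fixes u v :: real
  assumes \<rho>: "\<rho> = sqrt (u * u + v * v)" "0 < \<rho>"
    and \<phi>: "\<phi> = (if v < 0 then 2 * pi - arccos (u / \<rho>) else arccos (u / \<rho>))"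
  shows "u = \<rho> * cos \<phi>" "v = \<rho> * sin \<phi>" "\<phi> \<in> {0..2 * pi}"
proof -
  have sq: "\<rho>\<^sup>2 = u\<^sup>2 + v\<^sup>2"
    by (simp add: \<rho>(1) power2_eq_square)
  then have "u\<^sup>2 \<le> \<rho>\<^sup>2" by simp
  then have "\<bar>u\<bar> \<le> \<rho>" using \<rho>(2) by (simp add: abs_le_square_iff[symmetric])
  then have bd: "-1 \<le> u / \<rho>" "u / \<rho> \<le> 1"
    using \<rho>(2) by (auto simp: field_simps abs_le_iff)
  have "1 - (u / \<rho>)\<^sup>2 = (\<rho>\<^sup>2 - u\<^sup>2) / \<rho>\<^sup>2"
    using \<rho>(2) by (simp add: power_divide diff_divide_distrib)
  then have "1 - (u / \<rho>)\<^sup>2 = (v / \<rho>)\<^sup>2"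
    by (simp add: sq power_divide)
  then have sin: "sin (arccos (u / \<rho>)) = \<bar>v\<bar> / \<rho>"
    using bd \<rho>(2) by (simp add: sin_arccos)
  have cos: "cos (arccos (u / \<rho>)) = u / \<rho>"
    using bd by (simp add: cos_arccos)
  show "u = \<rho> * cos \<phi>" using \<rho>(2) cos by (simp add: \<phi> cos_diff)
  show "v = \<rho> * sin \<phi>" using \<rho>(2) sin by (simp add: \<phi> sin_diff)
  show "\<phi> \<in> {0..2 * pi}"
    using arccos_bounded[OF bd] pi_gt_zero by (auto simp: \<phi>)
qed

text \<open>Both sides are nonnegative, so they can be squared. A rotation preserves the norm of
  \<open>a\<close> and fixes its third coordinate, so the angle enters only through the inner
  product with \<open>b\<close>, which is linear in \<open>cos x\<close> and
  \<open>sin x\<close>.\<close>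

lemma residual_le_iff:
  assumes "0 < \<epsilon>"
  shows "norm (Rot x *v a - b) \<le> 2 * \<epsilon> \<longleftrightarrow>
    ((norm a)\<^sup>2 + (norm b)\<^sup>2 - 2 * \<epsilon> * (2 * \<epsilon>)) / 2 - a $ 3 * b $ 3
     \<le> (a $ 1 * b $ 1 + a $ 2 * b $ 2) * cos x + (a $ 2 * b $ 1 - a $ 1 * b $ 2) * sin x"
proof -
  have n: "(norm z)\<^sup>2 = z $ 1 * z $ 1 + z $ 2 * z $ 2 + z $ 3 * z $ 3" for z :: point
    by (simp add: norm_vec3 real_sqrt_pow2)
  have R: "(cos x * a1 + sin x * a2)\<^sup>2 + (cos x * a2 - sin x * a1)\<^sup>2 = a1 * a1 + a2 * a2" for a1 a2 :: real
  proof -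
    have "(cos x * a1 + sin x * a2)\<^sup>2 + (cos x * a2 - sin x * a1)\<^sup>2
      = ((cos x)\<^sup>2 + (sin x)\<^sup>2) * (a1 * a1 + a2 * a2)"
      unfolding power2_eq_square by algebra
    then show ?thesis by simp
  qed
  have "norm (Rot x *v a - b) \<le> 2 * \<epsilon> \<longleftrightarrow> (norm (Rot x *v a - b))\<^sup>2 \<le> (2 * \<epsilon>)\<^sup>2"
    using assms abs_le_square_iff[of "norm (Rot x *v a - b)" "2 * \<epsilon>"] by simp
  also have "(norm (Rot x *v a - b))\<^sup>2 = (norm a)\<^sup>2 + (norm b)\<^sup>2 -
    2 * ((a $ 1 * b $ 1 + a $ 2 * b $ 2) * cos x + (a $ 2 * b $ 1 - a $ 1 * b $ 2) * sin x + a $ 3 * b $ 3)"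
    using R[of "a $ 1" "a $ 2"] unfolding n
    by (simp add: Rot_mult power2_eq_square algebra_simps)
  finally show ?thesis
    by (simp add: power2_eq_square field_simps)
qed

lemma spec_if: "spec (if c then m else m') b P \<longleftrightarrow> (if c then spec m b P else spec m' b P)"
  by simp

lemma bind_if: "bind_comp (if c then m else m') f = (if c then bind_comp m f else bind_comp m' f)"
  by simp

lemma arcs_prog_spec:
  assumes "0 < \<epsilon>"
  shows "spec (arcs_prog \<epsilon> a b) 42 (\<lambda>iv. angle_intervals iv \<and> length iv \<le> 2 \<and>
    (\<forall>x\<in>{0..2 * pi}. covers iv x = of_bool (norm (Rot x *v a - b) \<le> 2 * \<epsilon>)))"
proof -
  define u v w where "u = a $ 1 * b $ 1 + a $ 2 * b $ 2" and "v = a $ 2 * b $ 1 - a $ 1 * b $ 2"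
    and "w = ((norm a)\<^sup>2 + (norm b)\<^sup>2 - 2 * \<epsilon> * (2 * \<epsilon>)) / 2 - a $ 3 * b $ 3"
  define \<rho> where "\<rho> = sqrt (u * u + v * v)"
  define \<phi> where "\<phi> = (if v < 0 then 2 * pi - arccos (u / \<rho>) else arccos (u / \<rho>))"
  define iv where "iv = (if w \<le> - \<rho> then [(0, 2 * pi)] else if \<rho> < w then [] else arcs_of \<phi> (arccos (w / \<rho>)))"
  have le: "norm (Rot x *v a - b) \<le> 2 * \<epsilon> \<longleftrightarrow> w \<le> u * cos x + v * sin x" for x
    unfolding residual_le_iff[OF assms] u_def v_def w_def ..
  \<comment> \<open>42 is the cost of the longest branch: \<open>v < 0\<close> and an arc wrapping
    on the right.\<close>
  have "spec (arcs_prog \<epsilon> a b) 42 ((=) iv)"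
    unfolding arcs_prog_def
    apply (rule spec_bind_eq[OF sqnorm_prog_spec], simp)
    apply (rule spec_bind_eq[OF sqnorm_prog_spec], simp)
    apply (simp only: spec_op_bind spec_if bind_if bind_ret spec_ret)
    apply (simp only: u_def[symmetric] v_def[symmetric])
    apply (simp only: w_def[symmetric] \<rho>_def[symmetric])
    apply (cases "w \<le> - \<rho>"; cases "\<rho> < w"; cases "v < 0"; simp add: iv_def arcs_of_def \<phi>_def)
    done
  moreover have "angle_intervals iv \<and> length iv \<le> 2 \<and>
    (\<forall>x\<in>{0..2 * pi}. covers iv x = of_bool (w \<le> u * cos x + v * sin x))"
  proof -
    \<comment> \<open>Cauchy-Schwarz for \<open>(u, v)\<close> and \<open>(cos x, sin x)\<close>,
      through Lagrange's identity.\<close>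
    have bound: "\<bar>u * cos x + v * sin x\<bar> \<le> \<rho>" for x
    proof -
      have "(u * cos x + v * sin x)\<^sup>2 + (u * sin x - v * cos x)\<^sup>2 = (u * u + v * v) * ((cos x)\<^sup>2 + (sin x)\<^sup>2)"
        unfolding power2_eq_square by algebra
      then have "(u * cos x + v * sin x)\<^sup>2 + (u * sin x - v * cos x)\<^sup>2 = u * u + v * v"
        by simp
      moreover have "0 \<le> (u * sin x - v * cos x)\<^sup>2"
        by simp
      ultimately have "(u * cos x + v * sin x)\<^sup>2 \<le> u * u + v * v"
        by linarith
      then show ?thesis
        unfolding \<rho>_def by (intro real_le_rsqrt) simp
    qed
    consider "w \<le> - \<rho>" | "\<rho> < w" | "- \<rho> < w" "w \<le> \<rho>" by linarith
    then show ?thesis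
    proof cases
      case 1
      have "w \<le> u * cos x + v * sin x" for x using 1 bound[of x] by linarith
      then show ?thesis using 1 by (auto simp: iv_def covers_def angle_intervals_def)
    next
      case 2
      have "\<not> w \<le> u * cos x + v * sin x" for x using 2 bound[of x] by linarith
      moreover have "\<not> w \<le> - \<rho>" using 2 bound[of 0] by linarith
      ultimately show ?thesis using 2 by (auto simp: iv_def covers_def angle_intervals_def)
    next
      case 3
      \<comment> \<open>The degenerate case \<open>\<rho> = 0\<close> falls under the first two
        cases. The strict \<open>- \<rho> < w\<close> is what gives \<open>\<alpha> < pi\<close>
        below.\<close>
      then have pos: "0 < \<rho>" by linarith
      note polar = polar[OF \<rho>_def pos \<phi>_def]
      have w: "-1 < w / \<rho>" "w / \<rho> \<le> 1" using 3 pos by (auto simp: field_simps)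
      have "arccos (w / \<rho>) < arccos (-1)" using w by (intro arccos_less_mono[THEN iffD2]) auto
      then have \<alpha>: "0 \<le> arccos (w / \<rho>)" "arccos (w / \<rho>) < pi" using w by (auto simp: arccos_lbound)
      have "w \<le> u * cos x + v * sin x \<longleftrightarrow> cos (arccos (w / \<rho>)) \<le> cos (x - \<phi>)" for x
      proof -
        have "u * cos x + v * sin x = \<rho> * cos (x - \<phi>)"
          by (subst polar(1), subst polar(2)) (simp add: cos_diff algebra_simps)
        then show ?thesis using w pos by (simp add: cos_arccos field_simps)
      qed
      moreover have "iv = arcs_of \<phi> (arccos (w / \<rho>))" using 3 by (simp add: iv_def)
      moreover have "length (arcs_of \<phi> (arccos (w / \<rho>))) \<le> 2" by (simp add: arcs_of_def)
      ultimately show ?thesis using arcs_of_correct[OF polar(3) \<alpha>] by simp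
    qed
  qed
  ultimately show ?thesis unfolding le by (elim spec_weaken) auto
qed

section \<open>Intervals of all matches and optimal stabbing points\<close>

definition compatible :: "real \<Rightarrow> match \<Rightarrow> match \<Rightarrow> real \<Rightarrow> bool" where
  "compatible \<epsilon> m m' x \<longleftrightarrow> norm (Rot x *v (fst m' - fst m) - (snd m' - snd m)) \<le> 2 * \<epsilon>"

lemma covers_append [simp]: "covers (iv @ iv') x = covers iv x + covers iv' x"
  by (simp add: covers_def)

lemma angle_intervals_append [simp]:
  "angle_intervals (iv @ iv') \<longleftrightarrow> angle_intervals iv \<and> angle_intervals iv'"
  by (auto simp: angle_intervals_def)

text \<open>The witness \<open>iv\<close> records the pairing of endpoints, which later sorting
  forgets. The 51 units per match are the tick, the index increment, the test for \<open>k\<close>,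
  two subtractions of 3 and 42 for the arcs.\<close>

lemma endpoints_prog_spec:
  assumes \<epsilon>: "0 < \<epsilon>"
  shows "spec (endpoints_prog \<epsilon> m k i C) (51 * length C + 1)
    (\<lambda>(ls, rs). \<exists>iv. ls = map fst iv \<and> rs = map snd iv \<and> angle_intervals iv \<and> length iv \<le> 2 * length C \<and>
      (\<forall>x\<in>{0..2 * pi}. covers iv x = (\<Sum>j<length C. of_bool (i + j \<noteq> k \<and> compatible \<epsilon> m (C ! j) x))))"
proof (induction C arbitrary: i)
  case Nil
  then show ?case by (simp add: angle_intervals_def covers_def)
next
  case (Cons m' C)
  let ?post = "\<lambda>(ls, rs). \<exists>iv. ls = map fst iv \<and> rs = map snd iv \<and> angle_intervals iv \<and>
    length iv \<le> 2 * length (m' # C) \<and>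
      (\<forall>x\<in>{0..2 * pi}. covers iv x =
        (\<Sum>j<length (m' # C). of_bool (i + j \<noteq> k \<and> compatible \<epsilon> m ((m' # C) ! j) x)))"
  let ?rest = "\<lambda>(ls, rs). bind_comp (op (i = k)) (\<lambda>self. if self then ret (ls, rs) else
       bind_comp (sub_prog (fst m') (fst m)) (\<lambda>a. bind_comp (sub_prog (snd m') (snd m))
         (\<lambda>b. bind_comp (arcs_prog \<epsilon> a b) (\<lambda>arcs. ret (map fst arcs @ ls, map snd arcs @ rs)))))"
  have step: "spec (?rest (ls, rs)) 49 ?post"
    if ls: "ls = map fst iv" "rs = map snd iv" "angle_intervals iv" "length iv \<le> 2 * length C"
      and cov: "\<forall>x\<in>{0..2 * pi}. covers iv x = (\<Sum>j<length C. of_bool (i + 1 + j \<noteq> k \<and> compatible \<epsilon> m (C ! j) x))"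
    for ls rs iv
  proof (cases "i = k")
    case True
    have "?post (ls, rs)"
      using ls cov True by (auto simp: sum.lessThan_Suc_shift simp del: sum.lessThan_Suc)
    then show ?thesis using True unfolding prod.case spec_op_bind by simp
  next
    case False
    have post: "?post (map fst arcs @ ls, map snd arcs @ rs)"
      if arcs: "angle_intervals arcs \<and> length arcs \<le> 2 \<and> (\<forall>x\<in>{0..2 * pi}. covers arcs x =
          of_bool (norm (Rot x *v (fst m' - fst m) - (snd m' - snd m)) \<le> 2 * \<epsilon>))" for arcs
      unfolding prod.case
    proof (intro exI[of _ "arcs @ iv"] conjI ballI)
      fix x :: real assume x: "x \<in> {0..2 * pi}"
      show "covers (arcs @ iv) x =
        (\<Sum>j<length (m' # C). of_bool (i + j \<noteq> k \<and> compatible \<epsilon> m ((m' # C) ! j) x))"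
        using False x cov arcs
        by (simp add: sum.lessThan_Suc_shift compatible_def del: sum.lessThan_Suc)
    qed (use ls arcs in auto)
    let ?ret = "\<lambda>arcs. ret (map fst arcs @ ls, map snd arcs @ rs)"
    have "spec (bind_comp (arcs_prog \<epsilon> (fst m' - fst m) (snd m' - snd m)) ?ret) 42 ?post"
    proof (rule spec_bind[OF arcs_prog_spec[OF \<epsilon>], where b = 0])
      fix arcs
      assume "angle_intervals arcs \<and> length arcs \<le> 2 \<and> (\<forall>x\<in>{0..2 * pi}. covers arcs x =
          of_bool (norm (Rot x *v (fst m' - fst m) - (snd m' - snd m)) \<le> 2 * \<epsilon>))"
      then show "spec (?ret arcs) 0 ?post"
        unfolding spec_ret by (rule post)
    qed simp
    then have "spec (bind_comp (sub_prog (snd m') (snd m)) (\<lambda>b. bind_comp (arcs_prog \<epsilon> (fst m' - fst m) b) ?ret))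
        (3 + 42) ?post"
      by - (rule spec_bind[OF sub_prog_spec _ order.refl], erule subst)
    then have "spec (bind_comp (sub_prog (fst m') (fst m)) (\<lambda>a. bind_comp (sub_prog (snd m') (snd m))
        (\<lambda>b. bind_comp (arcs_prog \<epsilon> a b) ?ret))) (3 + (3 + 42)) ?post"
      by - (rule spec_bind[OF sub_prog_spec _ order.refl], erule subst)
    then show ?thesis
      using False unfolding prod.case spec_op_bind by simp
  qed
  have "spec (bind_comp (endpoints_prog \<epsilon> m k (i + 1) C) ?rest) (51 * length C + 1 + 49) ?post"
  proof (rule spec_bind[OF Cons.IH[of "i + 1"] _ order.refl])
    fix x
    assume "case x of (ls, rs) \<Rightarrow> \<exists>iv. ls = map fst iv \<and> rs = map snd iv \<and> angle_intervals iv \<and>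
      length iv \<le> 2 * length C \<and>
      (\<forall>x\<in>{0..2 * pi}. covers iv x = (\<Sum>j<length C. of_bool (i + 1 + j \<noteq> k \<and> compatible \<epsilon> m (C ! j) x)))"
    then obtain iv where x: "x = (map fst iv, map snd iv)"
      and iv: "angle_intervals iv" "length iv \<le> 2 * length C"
        "\<forall>x\<in>{0..2 * pi}. covers iv x = (\<Sum>j<length C. of_bool (i + 1 + j \<noteq> k \<and> compatible \<epsilon> m (C ! j) x))"
      by (cases x) (simp only: prod.case, blast)
    show "spec (?rest x) 49 ?post"
      unfolding x by (rule step[OF refl refl iv])
  qed
  then show ?case
    by (simp del: prod.case)
qed

lemma length_filter_mono:
  assumes "\<And>y. y \<in> set ys \<Longrightarrow> P y \<Longrightarrow> Q y"
  shows "length (filter P ys) \<le> length (filter Q ys)"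
  using assms by (induction ys) (auto simp: le_SucI)

text \<open>Moving from \<open>x\<close> down to the largest left endpoint not beyond
  \<open>x\<close> leaves none of the intervals containing \<open>x\<close>.\<close>

lemma covers_le_left_endpoint:
  assumes "covers iv x \<noteq> 0"
  shows "\<exists>l\<in>set (map fst iv). covers iv x \<le> covers iv l"
proof -
  define L where "L = {l \<in> set (map fst iv). l \<le> x}"
  have L: "finite L" "L \<noteq> {}"
    using assms by (fastforce simp: L_def covers_def filter_empty_conv)+
  have "covers iv x \<le> covers iv (Max L)"
    unfolding covers_def
  proof (rule length_filter_mono, clarify)
    fix l r assume lr: "(l, r) \<in> set iv" "l \<le> x" "x \<le> r"
    then have "l \<in> L" by (force simp: L_def)
    moreover have "Max L \<le> x" using Max_in[OF L] by (simp add: L_def)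
    ultimately show "l \<le> Max L \<and> Max L \<le> r" using lr L by auto
  qed
  moreover have "Max L \<in> set (map fst iv)" using Max_in[OF L] by (simp add: L_def)
  ultimately show ?thesis by blast
qed

text \<open>Endpoints \<open>51 * M + 1\<close>, two sorts of at most \<open>2 * M\<close> numbers
  at \<open>4 * M * d + 20 * M + 4\<close> each, sweep and final addition
  \<open>16 * M + 2\<close>.\<close>

definition solve_cost :: "nat \<Rightarrow> nat \<Rightarrow> nat" where
  "solve_cost M d = 8 * M * d + 107 * M + 11"

lemma solve_Q_prog_spec:
  assumes \<epsilon>: "0 < \<epsilon>" and k: "k < length C" and d: "2 * length C \<le> 2 ^ d"
  shows "spec (solve_Q_prog \<epsilon> C k (C ! k)) (solve_cost (length C) d) (\<lambda>(v, \<theta>). solves_Q \<epsilon> C k v \<theta>)"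
proof -
  define M where "M = length C"
  have main: "spec (bind_comp (sort_prog ls) (\<lambda>ls'. bind_comp (sort_prog rs) (\<lambda>rs'.
      bind_comp (sweep_prog ls' rs' 0 0 0) (\<lambda>(best, \<theta>). bind_comp (op (1 + best)) (\<lambda>v. ret (v, \<theta>))))))
     (2 * (4 * M * d + 20 * M + 4) + 16 * M + 2) (\<lambda>(v, \<theta>). solves_Q \<epsilon> C k v \<theta>)"
    if ls: "ls = map fst iv" "rs = map snd iv" and iv: "angle_intervals iv" "length iv \<le> 2 * M"
      and cov: "\<forall>x\<in>{0..2 * pi}. covers iv x = (\<Sum>j<length C. of_bool (0 + j \<noteq> k \<and> compatible \<epsilon> (C ! k) (C ! j) x))"
    for ls rs iv
  proof -
    have Q: "Q_obj \<epsilon> C k x = 1 + real (covers iv x)" if "x \<in> {0..2 * pi}" for x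
    proof -
      have "Q_obj \<epsilon> C k x = 1 + (\<Sum>j\<in>{..<length C} - {k}. of_bool (compatible \<epsilon> (C ! k) (C ! j) x))"
        by (simp add: Q_obj_def compatible_def)
      also have "(\<Sum>j\<in>{..<length C} - {k}. of_bool (compatible \<epsilon> (C ! k) (C ! j) x)) =
          (\<Sum>j<length C. of_bool (0 + j \<noteq> k \<and> compatible \<epsilon> (C ! k) (C ! j) x) :: real)"
        by (rule sum.mono_neutral_cong_left) auto
      finally show ?thesis using cov that by (simp add: of_nat_sum)
    qed
    have sort: "spec (sort_prog xs) (4 * M * d + 20 * M + 4) (\<lambda>ys. sorted ys \<and> mset ys = mset xs)"
      if "length xs = length iv" for xs
    proof -
      have le: "length xs \<le> 2 * M" using that iv by simp
      then have "length xs * d \<le> 2 * M * d" by (rule mult_le_mono1)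
      then have "2 * length xs * d + 10 * length xs + 4 \<le> 4 * M * d + 20 * M + 4"
        using le by linarith
      then show ?thesis
        using sort_prog_spec[of xs d] le d by (auto simp: M_def elim: spec_weaken)
    qed
    have sweep: "spec (bind_comp (sweep_prog ls' rs' 0 0 0) (\<lambda>(best, \<theta>). bind_comp (op (1 + best)) (\<lambda>v. ret (v, \<theta>))))
        (16 * M + 2) (\<lambda>(v, \<theta>). solves_Q \<epsilon> C k v \<theta>)"
      if ls': "sorted ls'" "mset ls' = mset ls" and rs': "sorted rs'" "mset rs' = mset rs" for ls' rs'
    proof -
      have set: "set ls' = fst ` set iv" "set rs' = snd ` set iv"
        using mset_eq_setD[OF ls'(2)] mset_eq_setD[OF rs'(2)] by (simp_all add: ls)
      have len: "length ls' = length iv" "length rs' = length iv"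
        using mset_eq_length[OF ls'(2)] mset_eq_length[OF rs'(2)] by (simp_all add: ls)
      have bal: "balance ls' rs' x = real (covers iv x)" for x
      proof -
        have "balance ls' rs' = balance (map fst iv) (map snd iv)"
          using ls'(2) rs'(2) by (intro balance_cong_mset) (simp_all add: ls)
        then show ?thesis
          using balance_eq_covers[of iv x] iv(1) by (auto simp: angle_intervals_def)
      qed
      have ex: "\<forall>l\<in>set ls'. \<exists>r\<in>set rs'. l \<le> r"
        using iv(1) by (force simp: set angle_intervals_def)
      have sol: "solves_Q \<epsilon> C k (1 + b) t"
        \<comment> \<open>The default \<open>b = 0\<close>, \<open>t = 0\<close> survives only if no
          left endpoint is covered; then no angle is, and 0 is a maximizer like any other.\<close>
        if b: "0 \<le> b" and all: "\<forall>x\<in>set ls'. 0 + balance ls' rs' x \<le> b"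
          and at: "b = 0 \<and> t = 0 \<or> t \<in> set ls' \<and> b \<le> 0 + balance ls' rs' t" for b t
      proof -
        have le: "real (covers iv x) \<le> b" for x
        proof (cases "covers iv x = 0")
          case False
          then obtain l where "l \<in> set ls'" "covers iv x \<le> covers iv l"
            using covers_le_left_endpoint[OF False] by (auto simp: set)
          then show ?thesis using all by (auto simp: bal intro: order.trans)
        qed (use b in simp)
        have t: "t \<in> {0..2 * pi}"
          using at iv(1) by (fastforce simp: set angle_intervals_def)
        have "b = real (covers iv t)"
          using at le[of t] by (auto simp: bal)
        then show ?thesis
          using le t by (auto simp: solves_Q_def is_arg_max_def Q not_less)
      qed
      show ?thesis
      proof (rule spec_bind[OF sweep_prog_spec[OF ls'(1) rs'(1) ex], where b = 1])
        show "4 * (length ls' + length rs') + 1 + 1 \<le> 16 * M + 2"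
          using len iv(2) by simp
        fix x :: "real \<times> real"
        assume "case x of (b, t) \<Rightarrow> 0 \<le> b \<and> (\<forall>x\<in>set ls'. 0 + balance ls' rs' x \<le> b) \<and>
          (b = 0 \<and> t = 0 \<or> t \<in> set ls' \<and> b \<le> 0 + balance ls' rs' t)"
        then show "spec (case x of (best, \<theta>) \<Rightarrow> bind_comp (op (1 + best)) (\<lambda>v. ret (v, \<theta>))) 1
            (\<lambda>(v, \<theta>). solves_Q \<epsilon> C k v \<theta>)"
          using sol[of "fst x" "snd x"] by (cases x) simp
      qed
    qed
    show ?thesis
      by (intro spec_bind[OF sort, OF _ spec_bind[OF sort, OF _ sweep order.refl]]) (auto simp: ls)
  qed
  have "spec (solve_Q_prog \<epsilon> C k (C ! k))
     (51 * length C + 1 + (2 * (4 * M * d + 20 * M + 4) + 16 * M + 2)) (\<lambda>(v, \<theta>). solves_Q \<epsilon> C k v \<theta>)"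
    unfolding solve_Q_prog_def
  proof (rule spec_bind[OF endpoints_prog_spec[OF \<epsilon>] _ order.refl])
    fix x
    assume "case x of (ls, rs) \<Rightarrow> \<exists>iv. ls = map fst iv \<and> rs = map snd iv \<and> angle_intervals iv \<and>
      length iv \<le> 2 * length C \<and>
      (\<forall>x\<in>{0..2 * pi}. covers iv x = (\<Sum>j<length C. of_bool (0 + j \<noteq> k \<and> compatible \<epsilon> (C ! k) (C ! j) x)))"
    then obtain iv where x: "x = (map fst iv, map snd iv)"
      and iv: "angle_intervals iv" "length iv \<le> 2 * M"
        "\<forall>x\<in>{0..2 * pi}. covers iv x = (\<Sum>j<length C. of_bool (0 + j \<noteq> k \<and> compatible \<epsilon> (C ! k) (C ! j) x))"
      unfolding M_def by (cases x) (simp only: prod.case, blast)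
    show "spec (case x of (ls, rs) \<Rightarrow> bind_comp (sort_prog ls) (\<lambda>ls'. bind_comp (sort_prog rs) (\<lambda>rs'.
        bind_comp (sweep_prog ls' rs' 0 0 0) (\<lambda>(best, \<theta>). bind_comp (op (1 + best)) (\<lambda>v. ret (v, \<theta>))))))
       (2 * (4 * M * d + 20 * M + 4) + 16 * M + 2) (\<lambda>(v, \<theta>). solves_Q \<epsilon> C k v \<theta>)"
      unfolding x prod.case by (rule main[OF refl refl iv])
  qed
  then show ?thesis
    by (rule spec_weaken) (simp_all add: solve_cost_def M_def algebra_simps)
qed

section \<open>The main loop and its running time\<close>

text \<open>Each solver run has one outcome, so its answers can be named in advance as
  \<open>Eb j\<close> and \<open>\<theta> j\<close>, and the program simulates the fold on sets. Of
  \<open>vs\<close>, the set decides the final pruning and the length its cost.\<close>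

lemma loop_prog_spec:
  assumes sol: "\<And>j. j < length C \<Longrightarrow> spec (solve_Q_prog \<epsilon> C j (C ! j)) K ((=) (Eb j, \<theta> j))"
    and "k \<le> length C" "ms = drop k C" "distinct D" "length D \<le> length C"
  shows "spec (loop_prog \<epsilon> C k ms E D vs) (length ms * (K + 23 * length C + 16) + 1)
    (\<lambda>(E', D', vs'). distinct D' \<and> length D' \<le> length C \<and>
       (E', set D') = fold (fmp_step \<epsilon> C Eb \<theta>) [k..<length C] (E, set D) \<and>
       length vs' = length vs + length ms \<and>
       set vs' = set vs \<union> (\<lambda>j. (C ! j, Eb j)) ` {k..<length C})"
  using assms(2-)
proof (induction ms arbitrary: k E D vs)
  case Nil
  then show ?case by simp
next
  case (Cons m ms)
  have "k < length C"
    using Cons.prems(2) by (metis drop_all list.distinct(1) not_le)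
  with Cons.prems(2) have k: "k < length C" "m = C ! k" "ms = drop (Suc k) C"
    by (simp_all flip: Cons_nth_drop_Suc)
  have ivl: "[k..<length C] = k # [Suc k..<length C]" "{k..<length C} = insert k {Suc k..<length C}"
    using k by (auto simp: upt_conv_Cons)
  let ?post = "\<lambda>(E', D', vs'). distinct D' \<and> length D' \<le> length C \<and>
       (E', set D') = fold (fmp_step \<epsilon> C Eb \<theta>) [k..<length C] (E, set D) \<and>
       length vs' = length vs + length (m # ms) \<and>
       set vs' = set vs \<union> (\<lambda>j. (C ! j, Eb j)) ` {k..<length C}"
  let ?c = "length ms * (K + 23 * length C + 16) + 1"
  have rest: "spec (loop_prog \<epsilon> C (k + 1) ms E' D' ((m, Eb k) # vs)) ?c ?post"
    if "distinct D'" "length D' \<le> length C" "(E', set D') = fmp_step \<epsilon> C Eb \<theta> k (E, set D)" for E' D'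
    using k that by (intro spec_weaken[OF Cons.IH]) (auto simp: ivl)
  \<comment> \<open>Both branches get the budget of the dearer one: rotation 8, subtraction 3,
    consensus \<open>23 * length C + 1\<close>.\<close>
  have prune: "spec (bind_comp (remove_prog m D) (\<lambda>D'. loop_prog \<epsilon> C (k + 1) ms E D' ((m, Eb k) # vs)))
      (23 * length C + 12 + ?c) ?post" if "Eb k < E"
  proof (rule spec_bind[OF remove_prog_spec])
    fix D' assume "removeAll m D = D'"
    then show "spec (loop_prog \<epsilon> C (k + 1) ms E D' ((m, Eb k) # vs)) ?c ?post"
      using that Cons.prems k
      by (intro rest) (auto simp: fmp_step_def distinct_removeAll intro: order.trans[OF length_removeAll_less_eq])
  qed (use Cons.prems in simp)
  have keep: "spec (bind_comp (rot_prog (\<theta> k) (fst m)) (\<lambda>a. bind_comp (sub_prog (snd m) a)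
        (\<lambda>t. bind_comp (consensus_prog \<epsilon> D (\<theta> k) t) (\<lambda>E'. loop_prog \<epsilon> C (k + 1) ms E' D ((m, Eb k) # vs)))))
      (23 * length C + 12 + ?c) ?post" if "\<not> Eb k < E"
  proof -
    let ?t = "snd m - Rot (\<theta> k) *v fst m"
    have "spec (bind_comp (consensus_prog \<epsilon> D (\<theta> k) ?t) (\<lambda>E'. loop_prog \<epsilon> C (k + 1) ms E' D ((m, Eb k) # vs)))
        (23 * length C + 1 + ?c) ?post"
    proof (rule spec_bind[OF consensus_prog_spec[OF Cons.prems(3)]])
      fix E' assume "consensus \<epsilon> (set D) (\<theta> k) ?t = E'"
      then show "spec (loop_prog \<epsilon> C (k + 1) ms E' D ((m, Eb k) # vs)) ?c ?post"
        using that Cons.prems k by (intro rest) (auto simp: fmp_step_def)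
    qed (use Cons.prems in simp)
    then have "spec (bind_comp (sub_prog (snd m) (Rot (\<theta> k) *v fst m))
        (\<lambda>t. bind_comp (consensus_prog \<epsilon> D (\<theta> k) t) (\<lambda>E'. loop_prog \<epsilon> C (k + 1) ms E' D ((m, Eb k) # vs))))
        (3 + (23 * length C + 1 + ?c)) ?post"
      by (intro spec_bind[OF sub_prog_spec _ order.refl]) simp
    then show ?thesis
      by (intro spec_bind[OF rot_prog_spec, where b = "3 + (23 * length C + 1 + ?c)"]) simp_all
  qed
  have body: "spec (bind_comp (op (k + 1)) (\<lambda>k'. bind_comp (op (Eb k < E)) (\<lambda>prune.
      if prune then bind_comp (remove_prog m D) (\<lambda>D'. loop_prog \<epsilon> C k' ms E D' ((m, Eb k) # vs))
      else bind_comp (rot_prog (\<theta> k) (fst m)) (\<lambda>a. bind_comp (sub_prog (snd m) a)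
        (\<lambda>t. bind_comp (consensus_prog \<epsilon> D (\<theta> k) t) (\<lambda>E'. loop_prog \<epsilon> C k' ms E' D ((m, Eb k) # vs)))))))
      (2 + (23 * length C + 12 + ?c)) ?post"
    using prune keep by (cases "Eb k < E") (simp_all only: spec_op_bind if_True if_False, simp_all)
  have "spec (solve_Q_prog \<epsilon> C k m) K ((=) (Eb k, \<theta> k))"
    using sol[OF k(1)] by (simp only: k(2))
  then have "spec (bind_comp (solve_Q_prog \<epsilon> C k m) (\<lambda>(v, \<theta>). bind_comp (op (k + 1)) (\<lambda>k'. bind_comp (op (v < E)) (\<lambda>prune.
      if prune then bind_comp (remove_prog m D) (\<lambda>D'. loop_prog \<epsilon> C k' ms E D' ((m, v) # vs))
      else bind_comp (rot_prog \<theta> (fst m)) (\<lambda>a. bind_comp (sub_prog (snd m) a)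
        (\<lambda>t. bind_comp (consensus_prog \<epsilon> D \<theta> t) (\<lambda>E'. loop_prog \<epsilon> C k' ms E' D ((m, v) # vs))))))))
      (K + (2 + (23 * length C + 12 + ?c))) ?post"
    by (rule spec_bind[OF _ _ order.refl]) (erule subst, simp only: prod.case, rule body)
  from spec_weaken[OF this, of "length (m # ms) * (K + 23 * length C + 16) + 1 - 1" ?post]
  show ?case
    unfolding loop_prog.simps spec_op_bind by (simp add: algebra_simps)
qed

text \<open>A fixed \<open>L\<close> bounds all intermediate lists, since removals only shorten
  them.\<close>

lemma final_prog_spec:
  assumes "length D \<le> L"
  shows "spec (final_prog E D vs) (length vs * (7 * L + 3) + 1)
    (\<lambda>D'. set D' = set D - {m. \<exists>v. (m, v) \<in> set vs \<and> v < E})"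
  using assms
proof (induction vs arbitrary: D)
  case Nil
  then show ?case by simp
next
  case (Cons mv vs)
  obtain m v where mv: "mv = (m, v)" by fastforce
  let ?post = "\<lambda>D'. set D' = set D - {m'. \<exists>v'. (m', v') \<in> set (mv # vs) \<and> v' < E}"
  show ?case
  proof (cases "v < E")
    case True
    have "spec (bind_comp (remove_prog m D) (\<lambda>D'. final_prog E D' vs))
      (7 * L + 1 + (length vs * (7 * L + 3) + 1)) ?post"
    proof (rule spec_bind[OF remove_prog_spec])
      fix D' assume D': "removeAll m D = D'"
      then have "length D' \<le> L"
        using Cons.prems length_removeAll_less_eq[of m D] by (metis order.trans)
      then show "spec (final_prog E D' vs) (length vs * (7 * L + 3) + 1) ?post"
        using D' True by (intro spec_weaken[OF Cons.IH order.refl]) (auto simp: mv)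
    qed (use Cons.prems in simp)
    then show ?thesis
      using True by (auto simp: mv algebra_simps)
  next
    case False
    have "spec (final_prog E D vs) (7 * L + 1 + (length vs * (7 * L + 3) + 1)) ?post"
      using False Cons.prems by (intro spec_weaken[OF Cons.IH[of D]]) (auto simp: mv)
    then show ?thesis
      using False by (auto simp: mv algebra_simps)
  qed
qed

text \<open>Turns a property of the unique outcome into a named value, so that \<open>Eb\<close> and
  \<open>\<theta>\<close> can be read off the solver.\<close>

lemma spec_exact:
  assumes "spec m b P"
  shows "\<exists>x. P x \<and> spec m b ((=) x)"
  using assms by (auto simp: spec_def)

definition fmp_cost :: "nat \<Rightarrow> nat \<Rightarrow> nat" where
  "fmp_cost M d = M * (7 * M + 2) + 1 + (M * (solve_cost M d + 23 * M + 16) + 1) + (M * (7 * M + 3) + 1)"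

lemma fmp_prog_spec:
  assumes \<epsilon>: "0 < \<epsilon>" and d: "2 * length C \<le> 2 ^ d"
  shows "spec (fmp_prog \<epsilon> C) (fmp_cost (length C) d)
    (\<lambda>C'. \<exists>Eb \<theta>. (\<forall>k<length C. solves_Q \<epsilon> C k (Eb k) (\<theta> k)) \<and> set C' = fmp \<epsilon> C Eb \<theta>)"
proof -
  \<comment> \<open>The bound on \<open>k\<close> sits inside the existential, so that choice yields
    a function on all indices.\<close>
  have "\<forall>k. \<exists>x. k < length C \<longrightarrow> (case x of (v, \<theta>) \<Rightarrow> solves_Q \<epsilon> C k v \<theta>) \<and>
     spec (solve_Q_prog \<epsilon> C k (C ! k)) (solve_cost (length C) d) ((=) x)"
    using spec_exact[OF solve_Q_prog_spec[OF \<epsilon> _ d]] by blast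
  then obtain f where f: "\<And>k. k < length C \<Longrightarrow> (case f k of (v, \<theta>) \<Rightarrow> solves_Q \<epsilon> C k v \<theta>) \<and>
     spec (solve_Q_prog \<epsilon> C k (C ! k)) (solve_cost (length C) d) ((=) (f k))"
    by metis
  define Eb \<theta> where "Eb = fst \<circ> f" and "\<theta> = snd \<circ> f"
  have sol: "\<forall>k<length C. solves_Q \<epsilon> C k (Eb k) (\<theta> k)"
    using f by (auto simp: Eb_def \<theta>_def case_prod_unfold)
  have run: "spec (solve_Q_prog \<epsilon> C k (C ! k)) (solve_cost (length C) d) ((=) (Eb k, \<theta> k))"
    if "k < length C" for k
    using f[OF that] by (simp add: Eb_def \<theta>_def)
  have "spec (fmp_prog \<epsilon> C) (length C * (7 * length C + 2) + 1 + ((length C * (solve_cost (length C) d + 23 * length C + 16) + 1)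
     + (length C * (7 * length C + 3) + 1))) (\<lambda>C'. set C' = fmp \<epsilon> C Eb \<theta>)"
    unfolding fmp_prog_def
  proof (rule spec_bind[OF to_set_prog_spec _ order.refl], elim conjE)
    fix D assume D: "distinct D" "set D = set C" "length D \<le> length C"
    show "spec (bind_comp (loop_prog \<epsilon> C 0 C 0 D []) (\<lambda>(E, D', vs). final_prog E D' vs))
       (length C * (solve_cost (length C) d + 23 * length C + 16) + 1 + (length C * (7 * length C + 3) + 1))
       (\<lambda>C'. set C' = fmp \<epsilon> C Eb \<theta>)"
    proof (rule spec_bind[OF loop_prog_spec _ order.refl])
      show "C = drop 0 C" by simp
      show "distinct D" "length D \<le> length C" by fact+
      show "spec (solve_Q_prog \<epsilon> C k (C ! k)) (solve_cost (length C) d) ((=) (Eb k, \<theta> k))" if "k < length C" for k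
        using that by (rule run)
      fix x
      assume "case x of (E', D', vs') \<Rightarrow> distinct D' \<and> length D' \<le> length C \<and>
        (E', set D') = fold (fmp_step \<epsilon> C Eb \<theta>) [0..<length C] (0, set D) \<and>
        length vs' = length [] + length C \<and>
        set vs' = set [] \<union> (\<lambda>j. (C ! j, Eb j)) ` {0..<length C}"
      then obtain E D' vs where x: "x = (E, D', vs)" and len: "length D' \<le> length C" "length vs = length C"
        and ED: "fold (fmp_step \<epsilon> C Eb \<theta>) [0..<length C] (0, set C) = (E, set D')"
        and vs: "set vs = (\<lambda>j. (C ! j, Eb j)) ` {0..<length C}"
        by (cases x) (simp add: D(2))
      have "fmp \<epsilon> C Eb \<theta> = set D' - {m. \<exists>v. (m, v) \<in> set vs \<and> v < E}"
        by (auto simp: fmp_def vs ED)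
      then show "spec (case x of (E, D', vs) \<Rightarrow> final_prog E D' vs) (length C * (7 * length C + 3) + 1)
          (\<lambda>C'. set C' = fmp \<epsilon> C Eb \<theta>)"
        using final_prog_spec[OF len(1), of E vs] by (simp add: x len(2))
    qed simp
  qed
  then show ?thesis
    by (rule spec_weaken) (use sol in \<open>auto simp: fmp_cost_def\<close>)
qed

lemma fmp_cost_le:
  assumes "real d \<le> x"
  shows "real (fmp_cost M d) \<le> real M * (7 * real M + 2) + 1 +
    (real M * (8 * real M * x + 107 * real M + 11 + 23 * real M + 16) + 1) + (real M * (7 * real M + 3) + 1)"
proof -
  have "real M * (8 * real M * real d) \<le> real M * (8 * real M * x)"
    using assms by (intro mult_left_mono) auto
  then show ?thesis
    by (simp add: fmp_cost_def solve_cost_def algebra_simps)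
qed

text \<open>The ceiling is replaced by \<open>log + 1\<close> to obtain an elementary function. The
  \<open>+ 1\<close> inside the logarithm makes it nonnegative for every \<open>M\<close>, including
  0.\<close>

lemma fmp_cost_bigo:
  "(\<lambda>M. real (fmp_cost M (nat \<lceil>log 2 (2 * real M + 1)\<rceil>))) \<in> O(\<lambda>M. (real M)\<^sup>2 * ln (real M))"
proof -
  let ?g = "\<lambda>M. real M * (7 * real M + 2) + 1 +
    (real M * (8 * real M * (log 2 (2 * real M + 1) + 1) + 107 * real M + 11 + 23 * real M + 16) + 1) +
    (real M * (7 * real M + 3) + 1)"
  have "(\<lambda>M. real (fmp_cost M (nat \<lceil>log 2 (2 * real M + 1)\<rceil>))) \<in> O(?g)"
  proof (rule landau_o.big_mono, rule always_eventually, rule allI)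
    fix M :: nat
    have "0 \<le> log 2 (2 * real M + 1)" by simp
    then have "real (nat \<lceil>log 2 (2 * real M + 1)\<rceil>) \<le> log 2 (2 * real M + 1) + 1" by linarith
    from fmp_cost_le[OF this, of M]
    show "norm (real (fmp_cost M (nat \<lceil>log 2 (2 * real M + 1)\<rceil>))) \<le> norm (?g M)"
      unfolding real_norm_def abs_of_nat by (rule order.trans[OF _ abs_ge_self])
  qed
  also have "?g \<in> O(\<lambda>M. (real M)\<^sup>2 * ln (real M))"
    by real_asymp
  finally show ?thesis .
qed

lemma two_power_ceiling_log: "2 * M \<le> 2 ^ nat \<lceil>log 2 (2 * real M + 1)\<rceil>"
proof -
  have "real (2 * M) \<le> 2 powr log 2 (2 * real M + 1)" by simp
  also have "\<dots> \<le> 2 powr real (nat \<lceil>log 2 (2 * real M + 1)\<rceil>)"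
    by (intro powr_mono) (auto intro: real_nat_ceiling_ge)
  also have "\<dots> = real (2 ^ nat \<lceil>log 2 (2 * real M + 1)\<rceil>)" by (subst powr_realpow) simp_all
  finally show ?thesis by (simp only: of_nat_le_iff)
qed

theorem mainTheorem4:
  shows "(\<forall>(\<epsilon>::real) > 0. \<forall>(C::match list) Eb \<theta>.
            (\<forall>k<length C. solves_Q \<epsilon> C k (Eb k) (\<theta> k)) \<longrightarrow>
            (\<forall>(\<theta>s, ts) \<in> argmax_consensus \<epsilon> (set C).
               inliers \<epsilon> (set C) \<theta>s ts \<subseteq> fmp \<epsilon> C Eb \<theta>) \<and>
            fmp \<epsilon> C Eb \<theta> \<subseteq> set C \<and>
            argmax_consensus \<epsilon> (set C) = argmax_consensus \<epsilon> (fmp \<epsilon> C Eb \<theta>))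
       \<and> (\<exists>T :: nat \<Rightarrow> real. T \<in> O(\<lambda>M. (real M)\<^sup>2 * ln (real M)) \<and>
            (\<forall>\<epsilon> > 0. \<forall>C :: match list. \<exists>C' n.
               outcomes (fmp_prog \<epsilon> C) = {(C', n)} \<and>
               real n \<le> T (length C) \<and>
               (\<exists>Eb \<theta>. (\<forall>k<length C. solves_Q \<epsilon> C k (Eb k) (\<theta> k)) \<and>
                        set C' = fmp \<epsilon> C Eb \<theta>)))"
proof (rule conjI)
  show "\<forall>(\<epsilon>::real) > 0. \<forall>(C::match list) Eb \<theta>.
            (\<forall>k<length C. solves_Q \<epsilon> C k (Eb k) (\<theta> k)) \<longrightarrow>
            (\<forall>(\<theta>s, ts) \<in> argmax_consensus \<epsilon> (set C).
               inliers \<epsilon> (set C) \<theta>s ts \<subseteq> fmp \<epsilon> C Eb \<theta>) \<and>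
            fmp \<epsilon> C Eb \<theta> \<subseteq> set C \<and>
            argmax_consensus \<epsilon> (set C) = argmax_consensus \<epsilon> (fmp \<epsilon> C Eb \<theta>)"
  proof (intro allI impI conjI)
    fix \<epsilon> :: real and C :: "match list" and Eb \<theta> :: "nat \<Rightarrow> real"
    assume sol: "\<forall>k<length C. solves_Q \<epsilon> C k (Eb k) (\<theta> k)"
    show "\<forall>(\<theta>s, ts) \<in> argmax_consensus \<epsilon> (set C). inliers \<epsilon> (set C) \<theta>s ts \<subseteq> fmp \<epsilon> C Eb \<theta>"
      using inliers_subset_fmp[OF sol] by blast
    show "fmp \<epsilon> C Eb \<theta> \<subseteq> set C" by (rule fmp_subset)
    show "argmax_consensus \<epsilon> (set C) = argmax_consensus \<epsilon> (fmp \<epsilon> C Eb \<theta>)"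
      by (intro argmax_consensus_eq fmp_subset inliers_subset_fmp[OF sol]) auto
  qed
  show "\<exists>T :: nat \<Rightarrow> real. T \<in> O(\<lambda>M. (real M)\<^sup>2 * ln (real M)) \<and>
            (\<forall>\<epsilon> > 0. \<forall>C :: match list. \<exists>C' n.
               outcomes (fmp_prog \<epsilon> C) = {(C', n)} \<and>
               real n \<le> T (length C) \<and>
               (\<exists>Eb \<theta>. (\<forall>k<length C. solves_Q \<epsilon> C k (Eb k) (\<theta> k)) \<and>
                        set C' = fmp \<epsilon> C Eb \<theta>))"
  \<comment> \<open>\<open>T\<close> is the explicit cost with \<open>d\<close> the rounded-up
    logarithm, large enough for sorting \<open>2 * M\<close> endpoints. It bounds the cost for every
    \<open>M\<close>; only its comparison with \<open>M^2 ln M\<close> is asymptotic.\<close>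
  proof (intro exI[of _ "\<lambda>M. real (fmp_cost M (nat \<lceil>log 2 (2 * real M + 1)\<rceil>))"] conjI allI impI)
    fix \<epsilon> :: real and C :: "match list"
    assume "0 < \<epsilon>"
    from fmp_prog_spec[OF this two_power_ceiling_log]
    show "\<exists>C' n. outcomes (fmp_prog \<epsilon> C) = {(C', n)} \<and>
        real n \<le> real (fmp_cost (length C) (nat \<lceil>log 2 (2 * real (length C) + 1)\<rceil>)) \<and>
        (\<exists>Eb \<theta>. (\<forall>k<length C. solves_Q \<epsilon> C k (Eb k) (\<theta> k)) \<and> set C' = fmp \<epsilon> C Eb \<theta>)"
      unfolding spec_def of_nat_le_iff .
  qed (rule fmp_cost_bigo)
qed

end
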